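(* Let $n>1$, let $\lambda\in\Bbbk$ be a primitive $n$th root of unity, and let $A=\Bbbk_\mu[u,v]$ or $A=A_1^\mu$, where $\mu\in\Bbbk^\times$ has finite multiplicative order $m>1$. Then $H_n(\lambda)$ acts linearly and inner faithfully on $A$ if and only if $m\mid n$. Moreover, the action is given by one of the following: (1) $g(u)=\mu u$, $g(v)=\lambda\mu v$, $x(u)=0$, $x(v)=\eta u$ for some $\eta\in\Bbbk^\times$, and if $A=A_1^\mu$ then $\lambda=\mu^{-2}$; or (2) $g(u)=\lambda\mu^{-1}u$, $g(v)=\mu^{-1}v$, $x(u)=\eta v$ for some $\eta\in\Bbbk^\times$, $x(v)=0$, and if $A=A_1^\mu$ then $\lambda=\mu^2$.
   Context: $\Bbbk$ is an algebraically closed field of characteristic zero; all algebras are $\Bbbk$-algebras. $\Bbbk_\mu[u,v]=\Bbbk\langle u,v\mid uv-\mu vu\rangle$ (quantum plane); $A_1^\mu=\Bbbk\langle u,v\mid uv-\mu vu-1\rangle$ (quantum Weyl algebra). The Taft algebra $H_n(\lambda)$ is the Hopf algebra generated by $g,x$ with relations $g^n=1$, $x^n=0$, $xg=\lambda gx$, and $\Delta(g)=g\otimes g$, $\Delta(x)=g\otimes x+x\otimes 1$, $\varepsilon(g)=1$, $\varepsilon(x)=0$, $S(g)=g^{n-1}$, $S(x)=-g^{n-1}x$. A Hopf algebra $H$ acts on $A$ if $A$ is a left $H$-module with $h\cdot 1=\varepsilon(h)1$ and $h\cdot(rr')=\sum(h_1\cdot r)(h_2\cdot r')$ for all $h\in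 H$, $r,r'\in A$. The action is inner faithful if no nonzero Hopf ideal of $H$ annihilates $A$. An action of $H_n(\lambda)$ on $A$ is linear if $g(u),g(v),x(u),x(v)\in\Bbbk u+\Bbbk v$.
   Formalization: For A = A_1^μ the criterion proved is "m | n and λ = μ^{-2} or λ = μ^2"; m | n alone does not suffice there (μ = λ = −1, m = n = 2 admits no such action). For the quantum plane the criterion is m | n, as stated. *)

theory Defs
  imports
    "HOL-Library.Poly_Mapping"
    "HOL-Computational_Algebra.Polynomial"
    "HOL-Algebra.QuotRing"
    "HOL-Algebra.Module"
begin

definition has_mult_order :: "'k::field \<Rightarrow> nat \<Rightarrow> bool" where
  "has_mult_order a m \<longleftrightarrow> 0 < m \<and> a ^ m = 1 \<and> (\<forall>k. 0 < k \<and> k < m \<longrightarrow> a ^ k \<noteq> 1)"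


section \<open>Free algebras and algebras given by generators and relations\<close>

text \<open>The free monoid on \<open>'x\<close>, written additively because multiplication in
  \<open>Poly_Mapping\<close> is convolution over an additive monoid: \<open>'x fword \<Rightarrow>\<^sub>0 'k\<close> is then
  the free associative unital algebra on \<open>'x\<close>.\<close>

datatype 'x fword = Word (letters: "'x list")

instantiation fword :: (type) monoid_add
begin

definition zero_fword :: "'x fword" where "zero_fword = Word []"

definition plus_fword :: "'x fword \<Rightarrow> 'x fword \<Rightarrow> 'x fword" where
  "plus_fword v w = Word (letters v @ letters w)"

instance
  by standard (simp_all add: zero_fword_def plus_fword_def)

end

type_synonym ('x, 'k) free_alg = "'x fword \<Rightarrow>\<^sub>0 'k"

definition gen :: "'x \<Rightarrow> ('x, 'k::field) free_alg" where
  "gen a = Poly_Mapping.single (Word [a]) 1"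

definition const :: "'k \<Rightarrow> ('x, 'k::field) free_alg" where
  "const c = Poly_Mapping.single 0 c"

definition scale :: "'k::field \<Rightarrow> ('i \<Rightarrow>\<^sub>0 'k) \<Rightarrow> ('i \<Rightarrow>\<^sub>0 'k)" where
  "scale c p = Poly_Mapping.map (\<lambda>d. c * d) p"

text \<open>Algebras over the type-class field \<open>'k\<close> are represented by the record type of
  HOL-Algebra that combines ring operations with a scalar multiplication.\<close>

definition free_algebra :: "('k::field, ('x, 'k) free_alg) module" where
  "free_algebra =
    \<lparr>carrier = UNIV, mult = (*), one = 1, zero = 0, add = (+), smult = scale\<rparr>"

definition quotient_algebra :: "('k, 'a) module \<Rightarrow> 'a set \<Rightarrow> ('k, 'a set) module" where
  "quotient_algebra A I =
    ring.extend (A Quot I)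
      (module.fields (\<lambda>c X. \<Union>a\<in>X. I +>\<^bsub>A\<^esub> (c \<odot>\<^bsub>A\<^esub> a)))"

definition rel_ideal :: "('x, 'k::field) free_alg set \<Rightarrow> ('x, 'k) free_alg set" where
  "rel_ideal R = Idl\<^bsub>free_algebra\<^esub> R"

definition presented_algebra ::
    "('x, 'k::field) free_alg set \<Rightarrow> ('k, ('x, 'k) free_alg set) module" where
  "presented_algebra R = quotient_algebra free_algebra (rel_ideal R)"

definition presented_class ::
    "('x, 'k::field) free_alg set \<Rightarrow> ('x, 'k) free_alg \<Rightarrow> ('x, 'k) free_alg set" where
  "presented_class R p = rel_ideal R +>\<^bsub>free_algebra\<^esub> p"


section \<open>Tensor products\<close>

text \<open>An element of \<open>A \<otimes> B\<close> is the coset, modulo the bilinearity relations, of a formal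
  linear combination of pairs. The set \<open>tensor_null A B\<close> is the span of those relations; it
  is a subspace because every relation occurs with an arbitrary coefficient \<open>c\<close>.\<close>

inductive_set tensor_null ::
    "('k::field, 'a, 'm) module_scheme \<Rightarrow> ('k, 'b, 'n) module_scheme \<Rightarrow> ('a \<times> 'b \<Rightarrow>\<^sub>0 'k) set"
  for A B where
  zero: "0 \<in> tensor_null A B"
| plus: "s \<in> tensor_null A B \<Longrightarrow> t \<in> tensor_null A B \<Longrightarrow> s + t \<in> tensor_null A B"
| add_left: "a \<in> carrier A \<Longrightarrow> a' \<in> carrier A \<Longrightarrow> b \<in> carrier B \<Longrightarrow>
    Poly_Mapping.single (a \<oplus>\<^bsub>A\<^esub> a', b) c - Poly_Mapping.single (a, b) c
      - Poly_Mapping.single (a', b) c \<in> tensor_null A B"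
| add_right: "a \<in> carrier A \<Longrightarrow> b \<in> carrier B \<Longrightarrow> b' \<in> carrier B \<Longrightarrow>
    Poly_Mapping.single (a, b \<oplus>\<^bsub>B\<^esub> b') c - Poly_Mapping.single (a, b) c
      - Poly_Mapping.single (a, b') c \<in> tensor_null A B"
| smult_left: "a \<in> carrier A \<Longrightarrow> b \<in> carrier B \<Longrightarrow>
    Poly_Mapping.single (d \<odot>\<^bsub>A\<^esub> a, b) c - Poly_Mapping.single (a, b) (c * d) \<in> tensor_null A B"
| smult_right: "a \<in> carrier A \<Longrightarrow> b \<in> carrier B \<Longrightarrow>
    Poly_Mapping.single (a, d \<odot>\<^bsub>B\<^esub> b) c - Poly_Mapping.single (a, b) (c * d) \<in> tensor_null A B"

definition tensor_class ::
    "('k::field, 'a, 'm) module_scheme \<Rightarrow> ('k, 'b, 'n) module_scheme \<Rightarrow>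
      ('a \<times> 'b \<Rightarrow>\<^sub>0 'k) \<Rightarrow> ('a \<times> 'b \<Rightarrow>\<^sub>0 'k) set" where
  "tensor_class A B t = {s. s - t \<in> tensor_null A B}"

text \<open>The product \<open>(a \<otimes> b)(a' \<otimes> b') = aa' \<otimes> bb'\<close>, on formal linear combinations.\<close>

definition tensor_mult ::
    "('k::field, 'a, 'm) module_scheme \<Rightarrow> ('k, 'b, 'n) module_scheme \<Rightarrow>
      ('a \<times> 'b \<Rightarrow>\<^sub>0 'k) \<Rightarrow> ('a \<times> 'b \<Rightarrow>\<^sub>0 'k) \<Rightarrow> ('a \<times> 'b \<Rightarrow>\<^sub>0 'k)" where
  "tensor_mult A B s t =
    (\<Sum>p\<in>Poly_Mapping.keys s. \<Sum>q\<in>Poly_Mapping.keys t.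
      Poly_Mapping.single (fst p \<otimes>\<^bsub>A\<^esub> fst q, snd p \<otimes>\<^bsub>B\<^esub> snd q) (Poly_Mapping.lookup s p * Poly_Mapping.lookup t q))"


section \<open>Hopf algebras, Hopf ideals and module algebras\<close>

text \<open>The coproduct \<open>\<Delta>(h)\<close> is an element of the tensor square, i.e. a coset of formal linear
  combinations: its members are the possible Sweedler expansions of \<open>h\<close>.\<close>

record (overloaded) ('k, 'h) hopf_algebra = "('k, 'h) module" +
  comult :: "'h \<Rightarrow> ('h \<times> 'h \<Rightarrow>\<^sub>0 'k) set"
  counit :: "'h \<Rightarrow> 'k"
  antipode :: "'h \<Rightarrow> 'h"

text \<open>\<open>\<Delta>(I) \<subseteq> I \<otimes> H + H \<otimes> I\<close> says that \<open>\<Delta>(h)\<close>, for \<open>h \<in> I\<close>, has a representative all of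
  whose terms lie in \<open>I \<times> H\<close> or in \<open>H \<times> I\<close>.\<close>

definition hopf_ideal :: "('k::field, 'h) hopf_algebra \<Rightarrow> 'h set \<Rightarrow> bool" where
  "hopf_ideal H I \<longleftrightarrow>
    ideal I H \<and>
    (\<forall>c. \<forall>h\<in>I. c \<odot>\<^bsub>H\<^esub> h \<in> I) \<and>
    (\<forall>h\<in>I. \<exists>t\<in>comult H h. Poly_Mapping.keys t \<subseteq> I \<times> carrier H \<union> carrier H \<times> I) \<and>
    (\<forall>h\<in>I. counit H h = 0) \<and>
    (\<forall>h\<in>I. antipode H h \<in> I)"

locale hopf_action =
  fixes H :: "('k::field, 'h) hopf_algebra"
    and A :: "('k, 'a) module"
    and act :: "'h \<Rightarrow> 'a \<Rightarrow> 'a"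
  assumes act_closed: "h \<in> carrier H \<Longrightarrow> r \<in> carrier A \<Longrightarrow> act h r \<in> carrier A"
    and act_add_left: "h \<in> carrier H \<Longrightarrow> h' \<in> carrier H \<Longrightarrow> r \<in> carrier A \<Longrightarrow>
      act (h \<oplus>\<^bsub>H\<^esub> h') r = act h r \<oplus>\<^bsub>A\<^esub> act h' r"
    and act_smult_left: "h \<in> carrier H \<Longrightarrow> r \<in> carrier A \<Longrightarrow>
      act (c \<odot>\<^bsub>H\<^esub> h) r = c \<odot>\<^bsub>A\<^esub> act h r"
    and act_add_right: "h \<in> carrier H \<Longrightarrow> r \<in> carrier A \<Longrightarrow> r' \<in> carrier A \<Longrightarrow>
      act h (r \<oplus>\<^bsub>A\<^esub> r') = act h r \<oplus>\<^bsub>A\<^esub> act h r'"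
    and act_smult_right: "h \<in> carrier H \<Longrightarrow> r \<in> carrier A \<Longrightarrow>
      act h (c \<odot>\<^bsub>A\<^esub> r) = c \<odot>\<^bsub>A\<^esub> act h r"
    and act_one: "r \<in> carrier A \<Longrightarrow> act \<one>\<^bsub>H\<^esub> r = r"
    and act_mult: "h \<in> carrier H \<Longrightarrow> h' \<in> carrier H \<Longrightarrow> r \<in> carrier A \<Longrightarrow>
      act (h \<otimes>\<^bsub>H\<^esub> h') r = act h (act h' r)"
    and act_on_one: "h \<in> carrier H \<Longrightarrow> act h \<one>\<^bsub>A\<^esub> = counit H h \<odot>\<^bsub>A\<^esub> \<one>\<^bsub>A\<^esub>"
    and act_on_mult: "h \<in> carrier H \<Longrightarrow> r \<in> carrier A \<Longrightarrow> r' \<in> carrier A \<Longrightarrow> t \<in> comult H h \<Longrightarrow>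
      act h (r \<otimes>\<^bsub>A\<^esub> r') =
        (\<Oplus>\<^bsub>A\<^esub>p\<in>Poly_Mapping.keys t. Poly_Mapping.lookup t p \<odot>\<^bsub>A\<^esub> (act (fst p) r \<otimes>\<^bsub>A\<^esub> act (snd p) r'))"

definition inner_faithful ::
    "('k::field, 'h) hopf_algebra \<Rightarrow> ('k, 'a) module \<Rightarrow> ('h \<Rightarrow> 'a \<Rightarrow> 'a) \<Rightarrow> bool" where
  "inner_faithful H A act \<longleftrightarrow>
    (\<forall>I. hopf_ideal H I \<and> (\<forall>h\<in>I. \<forall>r\<in>carrier A. act h r = \<zero>\<^bsub>A\<^esub>) \<longrightarrow> I = {\<zero>\<^bsub>H\<^esub>})"


section \<open>Hopf algebras given by generators and relations\<close>

text \<open>For \<open>H\<close> presented by relations \<open>R\<close>, let \<open>\<Delta>\<close> and \<open>\<epsilon>\<close> be the algebra homomorphisms, and \<open>S\<close>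
  the algebra antihomomorphism, with prescribed values \<open>d\<close>, \<open>e\<close>, \<open>s\<close> on the generators. They
  are first extended to the free algebra; the union over a coset \<open>X\<close> (or \<open>the_elem\<close>)
  then passes to the quotient, in the way \<open>FactRing\<close> does.\<close>

definition comult_free ::
    "('k::field, 'h, 'm) module_scheme \<Rightarrow> ('x \<Rightarrow> ('h \<times> 'h \<Rightarrow>\<^sub>0 'k)) \<Rightarrow>
      ('x, 'k) free_alg \<Rightarrow> ('h \<times> 'h \<Rightarrow>\<^sub>0 'k)" where
  "comult_free H d p =
    (\<Sum>w\<in>Poly_Mapping.keys p. scale (Poly_Mapping.lookup p w)
      (foldr (\<lambda>a. tensor_mult H H (d a)) (letters w) (Poly_Mapping.single (\<one>\<^bsub>H\<^esub>, \<one>\<^bsub>H\<^esub>) 1)))"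

definition counit_free :: "('x \<Rightarrow> 'k::field) \<Rightarrow> ('x, 'k) free_alg \<Rightarrow> 'k" where
  "counit_free e p = (\<Sum>w\<in>Poly_Mapping.keys p. Poly_Mapping.lookup p w * prod_list (map e (letters w)))"

definition antipode_free ::
    "('x \<Rightarrow> ('x, 'k::field) free_alg) \<Rightarrow> ('x, 'k) free_alg \<Rightarrow> ('x, 'k) free_alg" where
  "antipode_free s p =
    (\<Sum>w\<in>Poly_Mapping.keys p. scale (Poly_Mapping.lookup p w) (prod_list (map s (rev (letters w)))))"

definition presented_hopf_algebra ::
    "('x, 'k::field) free_alg set \<Rightarrow>
      ('x \<Rightarrow> (('x, 'k) free_alg set \<times> ('x, 'k) free_alg set \<Rightarrow>\<^sub>0 'k)) \<Rightarrow>
      ('x \<Rightarrow> 'k) \<Rightarrow> ('x \<Rightarrow> ('x, 'k) free_alg) \<Rightarrow> ('k, ('x, 'k) free_alg set) hopf_algebra" where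
  "presented_hopf_algebra R d e s =
    (let H = presented_algebra R in
      module.extend H
        (hopf_algebra.fields
          (\<lambda>X. \<Union>p\<in>X. tensor_class H H (comult_free H d p))
          (\<lambda>X. the_elem (counit_free e ` X))
          (\<lambda>X. \<Union>p\<in>X. presented_class R (antipode_free s p))))"


section \<open>Taft algebras\<close>

datatype taft_gen = Gen_g | Gen_x

definition taft_rels :: "nat \<Rightarrow> 'k::field \<Rightarrow> (taft_gen, 'k) free_alg set" where
  "taft_rels n q =
    {gen Gen_g ^ n - 1, gen Gen_x ^ n, gen Gen_x * gen Gen_g - const q * gen Gen_g * gen Gen_x}"

definition taft_g :: "nat \<Rightarrow> 'k::field \<Rightarrow> (taft_gen, 'k) free_alg set" where
  "taft_g n q = presented_class (taft_rels n q) (gen Gen_g)"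

definition taft_x :: "nat \<Rightarrow> 'k::field \<Rightarrow> (taft_gen, 'k) free_alg set" where
  "taft_x n q = presented_class (taft_rels n q) (gen Gen_x)"

definition taft_one :: "nat \<Rightarrow> 'k::field \<Rightarrow> (taft_gen, 'k) free_alg set" where
  "taft_one n q = presented_class (taft_rels n q) 1"

definition taft_algebra ::
    "nat \<Rightarrow> 'k::field \<Rightarrow> ('k, (taft_gen, 'k) free_alg set) hopf_algebra" where
  "taft_algebra n q =
    presented_hopf_algebra (taft_rels n q)
      (\<lambda>a. case a of
          Gen_g \<Rightarrow> Poly_Mapping.single (taft_g n q, taft_g n q) 1
        | Gen_x \<Rightarrow> Poly_Mapping.single (taft_g n q, taft_x n q) 1
                 + Poly_Mapping.single (taft_x n q, taft_one n q) 1)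
      (\<lambda>a. case a of Gen_g \<Rightarrow> 1 | Gen_x \<Rightarrow> 0)
      (\<lambda>a. case a of
          Gen_g \<Rightarrow> gen Gen_g ^ (n - 1)
        | Gen_x \<Rightarrow> - (gen Gen_g ^ (n - 1) * gen Gen_x))"


section \<open>Quantum planes and quantum Weyl algebras\<close>

datatype plane_gen = Gen_u | Gen_v

definition quantum_plane_rels :: "'k::field \<Rightarrow> (plane_gen, 'k) free_alg set" where
  "quantum_plane_rels \<mu> = {gen Gen_u * gen Gen_v - const \<mu> * gen Gen_v * gen Gen_u}"

definition quantum_weyl_rels :: "'k::field \<Rightarrow> (plane_gen, 'k) free_alg set" where
  "quantum_weyl_rels \<mu> = {gen Gen_u * gen Gen_v - const \<mu> * gen Gen_v * gen Gen_u - 1}"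

definition linear_taft_action ::
    "nat \<Rightarrow> 'k::field \<Rightarrow> (plane_gen, 'k) free_alg set \<Rightarrow>
      ((taft_gen, 'k) free_alg set \<Rightarrow> (plane_gen, 'k) free_alg set \<Rightarrow> (plane_gen, 'k) free_alg set) \<Rightarrow>
      bool" where
  "linear_taft_action n q R act \<longleftrightarrow>
    hopf_action (taft_algebra n q) (presented_algebra R) act \<and>
    (let A = presented_algebra R;
         u = presented_class R (gen Gen_u);
         v = presented_class R (gen Gen_v)
     in \<forall>h\<in>{taft_g n q, taft_x n q}. \<forall>r\<in>{u, v}. \<exists>a b. act h r = a \<odot>\<^bsub>A\<^esub> u \<oplus>\<^bsub>A\<^esub> b \<odot>\<^bsub>A\<^esub> v)"

end

theory Submission
  imports Defs
begin


text \<open>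
  The Taft algebra and the plane \<open>A\<close> are quotients of free algebras, so an action is a choice of two
  operators \<open>G\<close>, \<open>X\<close> on the free algebra \<open>k\<langle>u,v\<rangle>\<close>: an automorphism and a \<open>G\<close>-skew derivation that satisfy
  the Taft relations and preserve the defining ideal of \<open>A\<close>. For \<open>X d = \<eta> c\<close>, \<open>X c = 0\<close> the powers of \<open>X\<close>
  are controlled by \<open>X\<^sup>k d = (q\<alpha>)\<^sup>k d X\<^sup>k + \<eta> \<alpha>\<^sup>(\<^sup>k\<^sup>-\<^sup>1\<^sup>) [k]\<^sub>q c X\<^sup>(\<^sup>k\<^sup>-\<^sup>1\<^sup>)\<close> (left multiplications), and \<open>[n]\<^sub>q = 0\<close>.

  The action on \<open>A\<close> itself need not be faithful. Inner faithfulness holds because a Hopf ideal that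
  annihilates \<open>u\<close> and \<open>v\<close> annihilates all words in them, i.e. the whole free algebra, on which the Taft
  algebra acts faithfully.

  Conversely, for a linear action the images of the defining relation under \<open>g\<close> and \<open>x\<close> vanish in \<open>A\<close>, and
  their coefficients in the basis \<open>v\<^sup>i u\<^sup>j\<close> determine the matrices of \<open>g\<close> and \<open>x\<close> up to the two listed families;
  \<open>x\<close> cannot act by zero, since \<open>x\<close> generates a nonzero Hopf ideal.
\<close>

section \<open>Linear maps between spaces of finitely supported functions\<close>

text \<open>Faithfulness needs the free algebra, where words cannot cancel, while annihilation is
  only known on A. The two meet on span(u, v): it is stable under all operators and embeds in A, so
  an element that kills a generator in A kills it in the free algebra. Longer words follow letter by
  letter, because every element of a Hopf ideal has a coproduct expansion each of whose terms has a
  factor in the ideal.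

  Faithfulness itself rests on two separations: the number of letters \<open>d\<close>, which each
  \<open>X\<close> lowers by one, isolates the power of x; the weights q^b, pairwise different for b
  < n, isolate the power of g.

  Both families are one construction, with u and v exchanged and \<mu> inverted, and both algebras
  have the form uv - \<mu> vu = \<kappa>. The constant is where they part: g scales uv - \<mu> vu by
  q \<alpha>^2 but fixes \<kappa>, so A_1^\<mu> requires q \<alpha>^2 = 1. Divisibility alone
  therefore does not suffice for A_1^\<mu>, and the formal equivalence carries the restriction on
  q.\<close>

lemma lookup_scale [simp]: "Poly_Mapping.lookup (scale c p) k = c * Poly_Mapping.lookup p k"
  unfolding scale_def by (transfer) (simp add: when_def)

lemma scale_add_right: "scale c (p + r) = scale c p + scale c r"
  by (rule poly_mapping_eqI) (simp add: lookup_add algebra_simps)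

lemma scale_add_left: "scale (c + d) p = scale c p + scale d p"
  by (rule poly_mapping_eqI) (simp add: lookup_add algebra_simps)

lemma scale_scale [simp]: "scale c (scale d p) = scale (c * d) p"
  by (rule poly_mapping_eqI) (simp add: algebra_simps)

lemma scale_one [simp]: "scale 1 p = p"
  by (rule poly_mapping_eqI) simp

lemma scale_zero_left [simp]: "scale 0 p = 0"
  by (rule poly_mapping_eqI) simp

lemma scale_zero_right [simp]: "scale c 0 = 0"
  by (rule poly_mapping_eqI) simp

lemma scale_minus_left: "scale (- c) p = - scale c p"
  by (rule poly_mapping_eqI) simp

lemma scale_minus_right: "scale c (- p) = - scale c p"
  by (rule poly_mapping_eqI) simp

lemma scale_diff_right: "scale c (p - r) = scale c p - scale c r"
  by (rule poly_mapping_eqI) (simp add: lookup_minus algebra_simps)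

lemma scale_diff_left: "scale (c - d) p = scale c p - scale d p"
  by (rule poly_mapping_eqI) (simp add: lookup_minus algebra_simps)

lemma scale_single [simp]: "scale c (Poly_Mapping.single k d) = Poly_Mapping.single k (c * d)"
  by (rule poly_mapping_eqI) (simp add: lookup_single when_def)

lemma scale_sum: "scale c (\<Sum>i\<in>I. f i) = (\<Sum>i\<in>I. scale c (f i))"
  by (induction I rule: infinite_finite_induct) (simp_all add: scale_add_right)

lemma const_mult: "const c * p = scale c p"
  unfolding const_def scale_def by (rule mult_map_scale_conv_mult [symmetric])

lemma poly_mapping_expansion:
  "p = (\<Sum>k\<in>Poly_Mapping.keys p. Poly_Mapping.single k (Poly_Mapping.lookup p k))"
proof (rule poly_mapping_eqI)
  fix k
  show "Poly_Mapping.lookup p k = Poly_Mapping.lookup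
     (\<Sum>k\<in>Poly_Mapping.keys p. Poly_Mapping.single k (Poly_Mapping.lookup p k)) k"
    by (cases "k \<in> Poly_Mapping.keys p")
      (simp_all add: lookup_sum lookup_single when_def sum.delta in_keys_iff)
qed

lemma poly_mapping_linear_induct [case_names zero add single]:
  fixes P :: "('i \<Rightarrow>\<^sub>0 'b::comm_monoid_add) \<Rightarrow> bool"
  assumes "P 0" "\<And>p r. P p \<Longrightarrow> P r \<Longrightarrow> P (p + r)" "\<And>k c. P (Poly_Mapping.single k c)"
  shows "P p"
proof -
  have "P (\<Sum>k\<in>K. Poly_Mapping.single k (f k))" if "finite K" for K f
    using that by (induction K rule: finite_induct) (use assms in auto)
  from this[of "Poly_Mapping.keys p" "Poly_Mapping.lookup p"] show ?thesis
    by (simp flip: poly_mapping_expansion)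
qed

lemma mult_scale_left [simp]: "scale c p * r = scale c (p * r)"
  for p r :: "'i::monoid_add \<Rightarrow>\<^sub>0 'k::field"
  by (simp add: scale_def mult_map_scale_conv_mult mult.assoc)

lemma mult_scale_right [simp]: "p * scale c r = scale c (p * r)"
  for p r :: "'i::monoid_add \<Rightarrow>\<^sub>0 'k::field"
proof (induction p rule: poly_mapping_linear_induct)
  case (single k d)
  show ?case
  proof (induction r rule: poly_mapping_linear_induct)
    case (single l e)
    then show ?case by (simp add: mult_single mult.left_commute)
  qed (simp_all add: scale_add_right distrib_left)
qed (simp_all add: scale_add_right distrib_right)

definition lin :: "(('i \<Rightarrow>\<^sub>0 'k::field) \<Rightarrow> ('j \<Rightarrow>\<^sub>0 'k)) \<Rightarrow> bool" where
  "lin f \<longleftrightarrow> (\<forall>p r. f (p + r) = f p + f r) \<and> (\<forall>c p. f (scale c p) = scale c (f p))"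

lemma lin_add: "lin f \<Longrightarrow> f (p + r) = f p + f r"
  and lin_scale: "lin f \<Longrightarrow> f (scale c p) = scale c (f p)"
  by (simp_all add: lin_def)

lemma lin_zero: "lin f \<Longrightarrow> f 0 = 0"
  using lin_scale[of f 0 0] by simp

lemma lin_minus: "lin f \<Longrightarrow> f (- p) = - f p"
  using lin_scale[of f "-1" p] by (simp add: scale_minus_left)

lemma lin_diff: "lin f \<Longrightarrow> f (p - r) = f p - f r"
  using lin_add[of f p "- r"] by (simp add: lin_minus)

lemma lin_sum: "lin f \<Longrightarrow> f (\<Sum>i\<in>I. g i) = (\<Sum>i\<in>I. f (g i))"
  by (induction I rule: infinite_finite_induct) (simp_all add: lin_add lin_zero)

lemma lin_single: "lin f \<Longrightarrow> f (Poly_Mapping.single k c) = scale c (f (Poly_Mapping.single k 1))"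
  using lin_scale[of f c "Poly_Mapping.single k 1"] by simp

lemma lin_eqI:
  assumes "lin f" "lin g" "\<And>k. f (Poly_Mapping.single k 1) = g (Poly_Mapping.single k 1)"
  shows "f p = g p"
proof (induction p rule: poly_mapping_linear_induct)
  case (single k c)
  then show ?case using assms by (metis lin_single)
qed (use assms in \<open>simp_all add: lin_zero lin_add\<close>)

lemma lin_id: "lin (\<lambda>p. p)"
  by (simp add: lin_def)

lemma lin_const_zero: "lin (\<lambda>p. 0)"
  by (simp add: lin_def)

lemma lin_comp: "lin f \<Longrightarrow> lin g \<Longrightarrow> lin (\<lambda>p. f (g p))"
  by (simp add: lin_def)

lemma lin_scaled: "lin f \<Longrightarrow> lin (\<lambda>p. scale c (f p))"
  by (simp_all add: lin_def scale_add_right mult.commute algebra_simps)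

lemma lin_mult_left: "lin f \<Longrightarrow> lin (\<lambda>p. r * f p)"
  and lin_mult_right: "lin f \<Longrightarrow> lin (\<lambda>p. f p * r)"
  for f :: "_ \<Rightarrow> ('j::monoid_add \<Rightarrow>\<^sub>0 'k::field)"
  by (simp_all add: lin_def distrib_left distrib_right)

lemma lin_funpow: "lin f \<Longrightarrow> lin (f ^^ k)" for f :: "('i \<Rightarrow>\<^sub>0 'k::field) \<Rightarrow> ('i \<Rightarrow>\<^sub>0 'k)"
  by (induction k) (auto simp: lin_def)

definition linext :: "('i \<Rightarrow> ('j \<Rightarrow>\<^sub>0 'k)) \<Rightarrow> ('i \<Rightarrow>\<^sub>0 'k::field) \<Rightarrow> ('j \<Rightarrow>\<^sub>0 'k)" where
  "linext b p = (\<Sum>k\<in>Poly_Mapping.keys p. scale (Poly_Mapping.lookup p k) (b k))"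

lemma linext_single [simp]: "linext b (Poly_Mapping.single k c) = scale c (b k)"
  by (simp add: linext_def)

lemma lin_linext: "lin (linext b)"
  unfolding lin_def
proof (intro conjI allI)
  show "linext b (p + r) = linext b p + linext b r" for p r
    unfolding linext_def
    by (rule setsum_keys_plus_distrib) (simp_all add: scale_add_left)
  show "linext b (scale c p) = scale c (linext b p)" for c p
  proof (cases "c = 0")
    case False
    then have "Poly_Mapping.keys (scale c p) = Poly_Mapping.keys p" by (auto simp: in_keys_iff)
    then show ?thesis by (simp add: linext_def scale_sum)
  qed (simp add: linext_def)
qed

section \<open>Representations of the free algebra by operators\<close>

definition rep :: "('x \<Rightarrow> ('j \<Rightarrow>\<^sub>0 'k) \<Rightarrow> ('j \<Rightarrow>\<^sub>0 'k)) \<Rightarrow> ('x, 'k::field) free_alg \<Rightarrow>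
    ('j \<Rightarrow>\<^sub>0 'k) \<Rightarrow> ('j \<Rightarrow>\<^sub>0 'k)" where
  "rep T p m = linext (\<lambda>w. foldr T (letters w) m) p"

lemma lin_foldr: "(\<And>a. lin (T a)) \<Longrightarrow> lin (foldr T as)"
  by (induction as) (simp_all add: lin_def)

lemma lin_rep_left: "lin (\<lambda>p. rep T p m)"
  unfolding rep_def by (rule lin_linext)

lemmas rep_add_left = lin_add[OF lin_rep_left]
  and rep_scale_left = lin_scale[OF lin_rep_left]
  and rep_diff_left = lin_diff[OF lin_rep_left]
  and rep_zero_left = lin_zero[OF lin_rep_left]

lemma rep_single: "rep T (Poly_Mapping.single w c) m = scale c (foldr T (letters w) m)"
  by (simp add: rep_def)

lemma rep_one [simp]: "rep T 1 m = m"
  unfolding single_one [symmetric] rep_single by (simp add: zero_fword_def)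

lemma rep_gen [simp]: "rep T (gen a) m = T a m"
  by (simp add: gen_def rep_single)

lemma rep_const [simp]: "rep T (const c) m = scale c m"
  by (simp add: const_def rep_single zero_fword_def)

context
  fixes T :: "'x \<Rightarrow> ('j \<Rightarrow>\<^sub>0 'k::field) \<Rightarrow> ('j \<Rightarrow>\<^sub>0 'k)"
  assumes lin_T: "\<And>a. lin (T a)"
begin

lemma lin_rep: "lin (rep T p)"
proof (induction p rule: poly_mapping_linear_induct)
  case (add p r)
  then show ?case by (simp add: lin_def rep_add_left algebra_simps scale_add_right)
next
  case (single w c)
  then show ?case using lin_foldr[OF lin_T, where as = "letters w"]
    by (simp add: lin_def rep_single scale_add_right mult.commute)
qed (simp add: lin_def rep_zero_left)

lemma rep_mult: "rep T (p * r) m = rep T p (rep T r m)"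
proof -
  have lin1: "lin (\<lambda>r. rep T (s * f r) m)" if "lin f" for s and f :: "('x, 'k) free_alg \<Rightarrow> _"
    by (intro lin_comp[OF lin_rep_left] lin_mult_left that)
  have lin2: "lin (\<lambda>r. rep T (f r * s) m)" if "lin f" for s and f :: "('x, 'k) free_alg \<Rightarrow> _"
    by (intro lin_comp[OF lin_rep_left] lin_mult_right that)
  have lin4: "lin (\<lambda>r. rep T s (rep T r m))" for s
    by (intro lin_comp[OF lin_rep] lin_rep_left)
  have single: "rep T (Poly_Mapping.single v 1 * r) m = rep T (Poly_Mapping.single v 1) (rep T r m)" for v
    by (rule lin_eqI[of "\<lambda>r. rep T (Poly_Mapping.single v 1 * r) m"])
      (simp_all add: lin1 lin4 lin_id, simp add: mult_single rep_single plus_fword_def)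
  show ?thesis
    by (rule lin_eqI[of "\<lambda>p. rep T (p * r) m"])
      (simp_all add: lin2 lin_rep_left lin_id single)
qed

lemma rep_power: "rep T (p ^ k) m = (rep T p ^^ k) m"
  by (induction k) (simp_all add: rep_mult)

end



section \<open>Presented algebras\<close>

lemma free_algebra_simps [simp]:
  "carrier free_algebra = UNIV" "mult free_algebra = (*)" "one free_algebra = 1"
  "zero free_algebra = 0" "add free_algebra = (+)" "smult free_algebra = scale"
  by (simp_all add: free_algebra_def)

lemma ring_free_algebra: "ring free_algebra"
proof (rule ringI)
  show "abelian_group free_algebra"
  proof (rule abelian_groupI)
    show "\<exists>y\<in>carrier free_algebra. y \<oplus>\<^bsub>free_algebra\<^esub> x = \<zero>\<^bsub>free_algebra\<^esub>" 
      for x :: "('x, 'k::field) free_alg"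
      by (simp, rule exI[of _ "- x"], simp)
  qed (simp_all add: ac_simps)
  show "Group.monoid free_algebra"
    by (rule monoidI) (simp_all add: mult.assoc)
qed (simp_all add: algebra_simps)

lemma ideal_rel_ideal: "ideal (rel_ideal R) free_algebra"
  unfolding rel_ideal_def by (rule ring.genideal_ideal[OF ring_free_algebra]) simp

lemma rel_ideal_zero [simp]: "0 \<in> rel_ideal R"
  using additive_subgroup.zero_closed[OF ideal.axioms(1)[OF ideal_rel_ideal]] by simp

lemma rel_ideal_add: "p \<in> rel_ideal R \<Longrightarrow> r \<in> rel_ideal R \<Longrightarrow> p + r \<in> rel_ideal R"
  using additive_subgroup.a_closed[OF ideal.axioms(1)[OF ideal_rel_ideal]] by force

lemma rel_ideal_mult_left: "p \<in> rel_ideal R \<Longrightarrow> r * p \<in> rel_ideal R"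
  using ideal.I_l_closed[OF ideal_rel_ideal] by force

lemma rel_ideal_mult_right: "p \<in> rel_ideal R \<Longrightarrow> p * r \<in> rel_ideal R"
  using ideal.I_r_closed[OF ideal_rel_ideal] by force

lemma rel_ideal_scale: "p \<in> rel_ideal R \<Longrightarrow> scale c p \<in> rel_ideal R"
  using rel_ideal_mult_left[of p R "const c"] by (simp add: const_mult)

lemma rel_ideal_minus: "p \<in> rel_ideal R \<Longrightarrow> - p \<in> rel_ideal R"
  using rel_ideal_mult_left[of p R "-1"] by simp

lemma rel_ideal_diff: "p \<in> rel_ideal R \<Longrightarrow> r \<in> rel_ideal R \<Longrightarrow> p - r \<in> rel_ideal R"
  using rel_ideal_add[of p R "- r"] by (simp add: rel_ideal_minus)

lemma rel_ideal_base: "p \<in> R \<Longrightarrow> p \<in> rel_ideal R"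
  unfolding rel_ideal_def using ring.genideal_self[OF ring_free_algebra, of R] by auto

text \<open>The elements with property \<open>P\<close> form a two-sided ideal containing
  \<open>R\<close>, so minimality of the generated ideal applies. Closure under negation comes from
  \<open>left\<close> with the factor -1.\<close>

lemma rel_ideal_induct [consumes 1, case_names base zero add left right]:
  assumes "p \<in> rel_ideal R"
    and base: "\<And>r. r \<in> R \<Longrightarrow> P r" and zero: "P 0"
    and add: "\<And>p r. P p \<Longrightarrow> P r \<Longrightarrow> P (p + r)"
    and left: "\<And>p r. P p \<Longrightarrow> P (r * p)" and right: "\<And>p r. P p \<Longrightarrow> P (p * r)"
  shows "P p"
proof -
  have "ideal {p. P p} free_algebra"
  proof (rule idealI[OF ring_free_algebra])
    show "subgroup {p. P p} (add_monoid free_algebra)"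
    proof (rule group.subgroupI)
      show "Group.group (add_monoid (free_algebra :: (_, (_, _) free_alg) module))"
        by (rule abelian_group.a_group, rule ring.is_abelian_group, rule ring_free_algebra)
      fix a assume "a \<in> {p. P p}"
      then have "P (- a)" using left[of a "-1"] by simp
      moreover have "inv\<^bsub>add_monoid free_algebra\<^esub> a = - a"
        using abelian_group.minus_equality[OF ring.is_abelian_group[OF ring_free_algebra], of "- a" a]
        by (simp add: a_inv_def)
      ultimately show "inv\<^bsub>add_monoid free_algebra\<^esub> a \<in> {p. P p}" by simp
    qed (use zero add in auto)
  qed (use left right in auto)
  then have "rel_ideal R \<subseteq> {p. P p}"
    unfolding rel_ideal_def by (rule ring.genideal_minimal[OF ring_free_algebra]) (use base in auto)
  then show ?thesis using assms(1) by auto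
qed

section \<open>Cosets and the operations on them\<close>

lemma mem_presented_class: "r \<in> presented_class R p \<longleftrightarrow> r - p \<in> rel_ideal R"
proof
  assume "r \<in> presented_class R p"
  then show "r - p \<in> rel_ideal R"
    by (auto simp: presented_class_def a_r_coset_def r_coset_def)
next
  assume "r - p \<in> rel_ideal R"
  then have "\<exists>h\<in>rel_ideal R. r = h + p" by (intro bexI[of _ "r - p"]) simp_all
  then show "r \<in> presented_class R p"
    by (auto simp: presented_class_def a_r_coset_def r_coset_def)
qed

lemma presented_class_self [simp]: "p \<in> presented_class R p"
  by (simp add: mem_presented_class)

lemma presented_class_eq_iff: "presented_class R p = presented_class R r \<longleftrightarrow> p - r \<in> rel_ideal R"
proof
  assume "presented_class R p = presented_class R r"
  then show "p - r \<in> rel_ideal R" by (metis mem_presented_class presented_class_self)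
next
  assume *: "p - r \<in> rel_ideal R"
  have "s - p \<in> rel_ideal R \<longleftrightarrow> s - r \<in> rel_ideal R" for s
    using rel_ideal_add[OF _ *, of "s - p"] rel_ideal_diff[OF _ *, of "s - r"] by auto
  then show "presented_class R p = presented_class R r"
    by (simp add: set_eq_iff mem_presented_class)
qed

lemma presented_class_eqI: "r \<in> presented_class R p \<Longrightarrow> presented_class R r = presented_class R p"
  by (simp add: mem_presented_class presented_class_eq_iff)

lemma carrier_presented: "carrier (presented_algebra R) = range (presented_class R)"
  by (auto simp: presented_algebra_def quotient_algebra_def FactRing_def A_RCOSETS_defs
      presented_class_def a_r_coset_def ring.defs module.defs)

lemma presented_class_closed [simp]: "presented_class R p \<in> carrier (presented_algebra R)"
  by (simp add: carrier_presented)

lemma mult_presented [simp]: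
  "presented_class R p \<otimes>\<^bsub>presented_algebra R\<^esub> presented_class R r = presented_class R (p * r)"
  using ideal.rcoset_mult_add[OF ideal_rel_ideal, of p r R]
  by (simp add: presented_algebra_def quotient_algebra_def FactRing_def presented_class_def
      ring.defs module.defs)

lemma one_presented: "\<one>\<^bsub>presented_algebra R\<^esub> = presented_class R 1"
  by (simp add: presented_algebra_def quotient_algebra_def FactRing_def presented_class_def
      ring.defs module.defs)

lemma presented_class_zero: "presented_class R 0 = rel_ideal R"
  by (auto simp: mem_presented_class)

lemma zero_presented: "\<zero>\<^bsub>presented_algebra R\<^esub> = presented_class R 0"
  unfolding presented_class_zero
  by (simp add: presented_algebra_def quotient_algebra_def FactRing_def ring.defs module.defs)

lemma add_presented [simp]:
  "presented_class R p \<oplus>\<^bsub>presented_algebra R\<^esub> presented_class R r = presented_class R (p + r)"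
proof -
  interpret ideal "rel_ideal R" free_algebra by (rule ideal_rel_ideal)
  show ?thesis
    using a_rcos_sum[of p r]
    by (simp add: presented_algebra_def quotient_algebra_def FactRing_def presented_class_def
      ring.defs module.defs)
qed

lemma smult_presented [simp]:
  "c \<odot>\<^bsub>presented_algebra R\<^esub> presented_class R p = presented_class R (scale c p)"
proof -
  have "presented_class R (scale c r) = presented_class R (scale c p)" if "r \<in> presented_class R p" for r
    using that rel_ideal_scale[of "r - p" R c]
    by (simp add: mem_presented_class presented_class_eq_iff scale_diff_right)
  then have "(\<Union>r\<in>presented_class R p. presented_class R (scale c r)) = presented_class R (scale c p)"
    using presented_class_self[of p R] by blast
  then show ?thesis
    by (simp add: presented_algebra_def quotient_algebra_def presented_class_def ring.defs module.defs)
qed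

lemma ring_presented_algebra: "ring (presented_algebra R)"
proof (rule ringI)
  show "abelian_group (presented_algebra R)"
  proof (rule abelian_groupI)
    fix x assume "x \<in> carrier (presented_algebra R)"
    then obtain p where "x = presented_class R p" by (auto simp: carrier_presented)
    then have "presented_class R (- p) \<oplus>\<^bsub>presented_algebra R\<^esub> x = \<zero>\<^bsub>presented_algebra R\<^esub>"
      by (simp add: zero_presented)
    then show "\<exists>y\<in>carrier (presented_algebra R). y \<oplus>\<^bsub>presented_algebra R\<^esub> x = \<zero>\<^bsub>presented_algebra R\<^esub>"
      using presented_class_closed by blast
  qed (auto simp: carrier_presented zero_presented ac_simps)
  show "Group.monoid (presented_algebra R)"
    by (rule monoidI) (auto simp: carrier_presented one_presented mult.assoc)
qed (auto simp: carrier_presented distrib_left distrib_right)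

lemma finsum_presented:
  "(\<Oplus>\<^bsub>presented_algebra R\<^esub>i\<in>I. presented_class R (f i)) = presented_class R (\<Sum>i\<in>I. f i)"
  if "finite I"
proof -
  interpret ring "presented_algebra R" by (rule ring_presented_algebra)
  show ?thesis using that
    by (induction I rule: finite_induct) (simp_all add: zero_presented)
qed



section \<open>Normal forms in the Taft algebra\<close>

lemma presented_class_mult_cong:
  "presented_class R p = presented_class R p' \<Longrightarrow> presented_class R r = presented_class R r' \<Longrightarrow>
    presented_class R (p * r) = presented_class R (p' * r')"
  by (metis mult_presented)

lemma presented_class_add_cong:
  "presented_class R p = presented_class R p' \<Longrightarrow> presented_class R r = presented_class R r' \<Longrightarrow>
    presented_class R (p + r) = presented_class R (p' + r')"
  by (metis add_presented)

lemma presented_class_scale_cong: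
  "presented_class R p = presented_class R p' \<Longrightarrow>
    presented_class R (scale c p) = presented_class R (scale c p')"
  by (metis smult_presented)

lemma presented_class_power_cong:
  "presented_class R p = presented_class R p' \<Longrightarrow> presented_class R (p ^ k) = presented_class R (p' ^ k)"
proof (induction k)
  case (Suc k)
  show ?case unfolding power.simps by (rule presented_class_mult_cong[OF Suc.prems Suc.IH[OF Suc.prems]])
qed simp

lemma presented_class_eq_zero_iff: "presented_class R p = presented_class R 0 \<longleftrightarrow> p \<in> rel_ideal R"
  by (simp add: presented_class_eq_iff)

text \<open>The kernel of a representation is a two-sided ideal. The vector \<open>m\<close> stays
  arbitrary in the induction because a factor on the right changes the vector on which the relation
  acts.\<close>

lemma rep_rel_ideal:
  assumes "\<And>a. lin (T a)" "\<And>r m. r \<in> R \<Longrightarrow> rep T r m = 0" "p \<in> rel_ideal R"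
  shows "rep T p m = 0"
  using assms(3)
proof (induction p arbitrary: m rule: rel_ideal_induct)
  case (left p r)
  then show ?case using lin_zero[OF lin_rep[OF assms(1)]] by (simp add: rep_mult[OF assms(1)])
qed (simp_all add: assms(2) rep_mult[OF assms(1)] rep_add_left rep_zero_left)

lemma rep_taft_rel_ideal:
  assumes lin: "\<And>a. lin (T a)"
    and "\<And>m. (T Gen_g ^^ n) m = m" "\<And>m. (T Gen_x ^^ n) m = 0"
    and "\<And>m. T Gen_x (T Gen_g m) = scale q (T Gen_g (T Gen_x m))"
    and "p \<in> rel_ideal (taft_rels n q)"
  shows "rep T p m = 0"
proof (rule rep_rel_ideal[OF lin _ assms(5)])
  have [simp]: "rep T (gen a) = T a" for a by (rule ext) simp
  fix r m assume "r \<in> taft_rels n q"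
  then show "rep T r m = 0"
    by (auto simp: taft_rels_def rep_diff_left rep_power[OF lin] rep_mult[OF lin] assms(2-4))
qed

abbreviation taft_class :: "nat \<Rightarrow> 'k::field \<Rightarrow> (taft_gen, 'k) free_alg \<Rightarrow> (taft_gen, 'k) free_alg set" where
  "taft_class n q \<equiv> presented_class (taft_rels n q)"

lemma taft_g_power: "taft_class n q (gen Gen_g ^ n) = taft_class n q 1"
  by (simp add: presented_class_eq_iff rel_ideal_base taft_rels_def)

lemma taft_x_power: "n \<le> k \<Longrightarrow> taft_class n q (gen Gen_x ^ k) = taft_class n q 0"
  using rel_ideal_mult_right[OF rel_ideal_base, of "gen Gen_x ^ n" "taft_rels n q" "gen Gen_x ^ (k - n)"]
  by (simp add: presented_class_eq_iff taft_rels_def flip: power_add)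

lemma taft_x_g: "taft_class n q (gen Gen_x * gen Gen_g) = taft_class n q (scale q (gen Gen_g * gen Gen_x))"
  unfolding presented_class_eq_iff
  by (rule rel_ideal_base) (simp add: taft_rels_def const_mult)

lemma taft_x_g_power:
  "taft_class n q (gen Gen_x * gen Gen_g ^ i) = taft_class n q (scale (q ^ i) (gen Gen_g ^ i * gen Gen_x))"
proof (induction i)
  case (Suc i)
  have "taft_class n q (gen Gen_x * gen Gen_g ^ Suc i) = taft_class n q ((gen Gen_x * gen Gen_g) * gen Gen_g ^ i)"
    by (simp add: mult.assoc)
  also have "\<dots> = taft_class n q (scale q (gen Gen_g * gen Gen_x) * gen Gen_g ^ i)"
    by (intro presented_class_mult_cong taft_x_g refl)
  also have "\<dots> = taft_class n q (scale q (gen Gen_g * (gen Gen_x * gen Gen_g ^ i)))"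
    by (simp add: mult.assoc)
  also have "\<dots> = taft_class n q (scale q (gen Gen_g * scale (q ^ i) (gen Gen_g ^ i * gen Gen_x)))"
    by (intro presented_class_scale_cong presented_class_mult_cong Suc refl)
  finally show ?case by (simp add: mult.assoc)
qed simp

lemma taft_x_power_g_power:
  "taft_class n q (gen Gen_x ^ j * gen Gen_g ^ i) =
    taft_class n q (scale (q ^ (i * j)) (gen Gen_g ^ i * gen Gen_x ^ j))"
proof (induction j)
  case (Suc j)
  have "taft_class n q (gen Gen_x ^ Suc j * gen Gen_g ^ i)
      = taft_class n q (gen Gen_x * (gen Gen_x ^ j * gen Gen_g ^ i))"
    by (simp add: mult.assoc)
  also have "\<dots> = taft_class n q (gen Gen_x * scale (q ^ (i * j)) (gen Gen_g ^ i * gen Gen_x ^ j))"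
    by (intro presented_class_mult_cong Suc refl)
  also have "\<dots> = taft_class n q (scale (q ^ (i * j)) ((gen Gen_x * gen Gen_g ^ i) * gen Gen_x ^ j))"
    by (simp add: mult.assoc)
  also have "\<dots> = taft_class n q (scale (q ^ (i * j))
      (scale (q ^ i) (gen Gen_g ^ i * gen Gen_x) * gen Gen_x ^ j))"
    by (intro presented_class_scale_cong presented_class_mult_cong taft_x_g_power refl)
  finally show ?case by (simp add: mult.assoc power_add mult.commute)
qed simp

text \<open>Only the exponent of x is recorded. It is additive under products and decides
  nilpotency, whereas the scalar (possibly 0) and the power of g never have to be computed.\<close>

definition taft_monomial :: "nat \<Rightarrow> 'k::field \<Rightarrow> nat \<Rightarrow> (taft_gen, 'k) free_alg \<Rightarrow> bool" where
  "taft_monomial n q j p \<longleftrightarrow>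
    (\<exists>c i. taft_class n q p = taft_class n q (scale c (gen Gen_g ^ i * gen Gen_x ^ j)))"

lemma taft_monomial_mult:
  assumes "taft_monomial n q j p" "taft_monomial n q l r"
  shows "taft_monomial n q (j + l) (p * r)"
proof -
  obtain c i d k where
    p: "taft_class n q p = taft_class n q (scale c (gen Gen_g ^ i * gen Gen_x ^ j))" and
    r: "taft_class n q r = taft_class n q (scale d (gen Gen_g ^ k * gen Gen_x ^ l))"
    using assms unfolding taft_monomial_def by blast
  have "taft_class n q (p * r) = taft_class n q (scale c (gen Gen_g ^ i * gen Gen_x ^ j) *
      scale d (gen Gen_g ^ k * gen Gen_x ^ l))"
    by (intro presented_class_mult_cong p r)
  also have "\<dots> = taft_class n q (scale (c * d)
      (gen Gen_g ^ i * ((gen Gen_x ^ j * gen Gen_g ^ k) * gen Gen_x ^ l)))"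
    by (simp add: mult.assoc mult.commute)
  also have "\<dots> = taft_class n q (scale (c * d)
      (gen Gen_g ^ i * (scale (q ^ (k * j)) (gen Gen_g ^ k * gen Gen_x ^ j) * gen Gen_x ^ l)))"
    by (intro presented_class_scale_cong presented_class_mult_cong taft_x_power_g_power refl)
  also have "\<dots> = taft_class n q (scale (c * d * q ^ (k * j)) (gen Gen_g ^ (i + k) * gen Gen_x ^ (j + l)))"
    by (simp add: mult.assoc power_add)
  finally show ?thesis unfolding taft_monomial_def by blast
qed

lemma taft_monomial_scale: "taft_monomial n q j p \<Longrightarrow> taft_monomial n q j (scale c p)"
  unfolding taft_monomial_def using presented_class_scale_cong[of "taft_rels n q" p _ c] by (metis scale_scale)

lemma taft_monomial_gen:
  "taft_monomial n q 0 1" "taft_monomial n q 0 (gen Gen_g ^ k)" "taft_monomial n q 1 (gen Gen_x)"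
  unfolding taft_monomial_def
  by (rule exI[of _ 1], rule exI[of _ 0], simp, rule exI[of _ 1], rule exI[of _ k], simp,
      rule exI[of _ 1], rule exI[of _ 0], simp)

lemma taft_monomial_power: "taft_monomial n q j p \<Longrightarrow> taft_monomial n q (k * j) (p ^ k)"
  by (induction k) (auto intro: taft_monomial_gen taft_monomial_mult)

lemma taft_monomial_high:
  assumes "taft_monomial n q j p" "n \<le> j"
  shows "p \<in> rel_ideal (taft_rels n q)"
proof -
  obtain c i where "taft_class n q p = taft_class n q (scale c (gen Gen_g ^ i * gen Gen_x ^ j))"
    using assms unfolding taft_monomial_def by blast
  also have "\<dots> = taft_class n q (scale c (gen Gen_g ^ i * 0))"
    by (intro presented_class_scale_cong presented_class_mult_cong taft_x_power assms refl)
  finally show ?thesis by (simp add: presented_class_eq_iff)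
qed

lemma single_word_Cons: "Poly_Mapping.single (Word (a # w)) 1 = gen a * Poly_Mapping.single (Word w) 1"
  by (simp add: gen_def mult_single plus_fword_def)

lemma taft_monomial_word: "\<exists>j. taft_monomial n q j (Poly_Mapping.single (Word w) 1)"
proof (induction w)
  case Nil
  have "Poly_Mapping.single (Word []) 1 = (1 :: (taft_gen, 'a) free_alg)"
    by (simp add: zero_fword_def flip: single_one)
  then show ?case using taft_monomial_gen(1) by metis
next
  case (Cons a w)
  have "\<exists>j. taft_monomial n q j (gen a :: (taft_gen, 'a) free_alg)"
    using taft_monomial_gen(2)[of n q 1] taft_monomial_gen(3) by (cases a) auto
  then show ?case using Cons taft_monomial_mult unfolding single_word_Cons by blast
qed

definition taft_normal :: "nat \<Rightarrow> (nat \<Rightarrow> nat \<Rightarrow> 'k) \<Rightarrow> (taft_gen, 'k::field) free_alg" where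
  "taft_normal n c = (\<Sum>j<n. \<Sum>i<n. scale (c i j) (gen Gen_g ^ i * gen Gen_x ^ j))"

lemma taft_normal_single:
  assumes "i < n" "j < n"
  shows "taft_normal n (\<lambda>i' j'. if i' = i \<and> j' = j then c else 0) =
    scale c (gen Gen_g ^ i * gen Gen_x ^ j)"
proof -
  have "taft_normal n (\<lambda>i' j'. if i' = i \<and> j' = j then c else 0) =
    (\<Sum>j'<n. \<Sum>i'<n. if i' = i then (if j' = j then scale c (gen Gen_g ^ i * gen Gen_x ^ j) else 0) else 0)"
    unfolding taft_normal_def by (intro sum.cong refl) simp
  also have "\<dots> = (\<Sum>j'<n. if j' = j then scale c (gen Gen_g ^ i * gen Gen_x ^ j) else 0)"
    using assms(1) by (simp add: sum.delta)
  also have "\<dots> = scale c (gen Gen_g ^ i * gen Gen_x ^ j)"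
    using assms(2) by (simp add: sum.delta)
  finally show ?thesis .
qed

lemma taft_normal_add: "taft_normal n c + taft_normal n d = taft_normal n (\<lambda>i j. c i j + d i j)"
  by (simp add: taft_normal_def scale_add_left sum.distrib)

text \<open>This is only the spanning half of the basis theorem. Independence of the monomials is
  obtained later from a faithful representation, in \<open>taft_normal_faithful\<close>.\<close>

lemma taft_normal_form:
  assumes "n > 0"
  shows "\<exists>c. taft_class n q p = taft_class n q (taft_normal n c)"
proof (induction p rule: poly_mapping_linear_induct)
  case zero
  show ?case by (rule exI[of _ "\<lambda>i j. 0"]) (simp add: taft_normal_def)
next
  case (add p r)
  then obtain c d where "taft_class n q p = taft_class n q (taft_normal n c)"
    "taft_class n q r = taft_class n q (taft_normal n d)" by blast
  from presented_class_add_cong[OF this] show ?case unfolding taft_normal_add by blast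
next
  case (single w d)
  obtain j where "taft_monomial n q j (Poly_Mapping.single w 1)"
    using taft_monomial_word[of n q "letters w"] by auto
  from taft_monomial_scale[OF this, of d]
  obtain c i where *: "taft_class n q (Poly_Mapping.single w d) =
      taft_class n q (scale c (gen Gen_g ^ i * gen Gen_x ^ j))"
    unfolding taft_monomial_def by auto
  show ?case
  proof (cases "j < n")
    case True
    have "(gen Gen_g ^ n) ^ (i div n) * gen Gen_g ^ (i mod n) = (gen Gen_g ^ i :: (taft_gen, 'a) free_alg)"
      by (metis mult_div_mod_eq power_add power_mult)
    moreover have "taft_class n q ((gen Gen_g ^ n) ^ (i div n) * gen Gen_g ^ (i mod n)) =
        taft_class n q (1 ^ (i div n) * gen Gen_g ^ (i mod n))"
      by (intro presented_class_mult_cong presented_class_power_cong taft_g_power refl)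
    ultimately have "taft_class n q (gen Gen_g ^ i) = taft_class n q (gen Gen_g ^ (i mod n))"
      by simp
    then have "taft_class n q (scale c (gen Gen_g ^ i * gen Gen_x ^ j)) =
        taft_class n q (scale c (gen Gen_g ^ (i mod n) * gen Gen_x ^ j))"
      by (intro presented_class_scale_cong presented_class_mult_cong) simp_all
    with * have "taft_class n q (Poly_Mapping.single w d) =
        taft_class n q (scale c (gen Gen_g ^ (i mod n) * gen Gen_x ^ j))" by simp
    also have "scale c (gen Gen_g ^ (i mod n) * gen Gen_x ^ j) =
        taft_normal n (\<lambda>i' j'. if i' = i mod n \<and> j' = j then c else 0)"
      using assms True by (intro taft_normal_single [symmetric]) simp_all
    finally show ?thesis by blast
  next
    case False
    have "taft_class n q (Poly_Mapping.single w d) = taft_class n q 0"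
    proof -
      have "taft_monomial n q j (Poly_Mapping.single w d)"
        unfolding taft_monomial_def using * by blast
      then show ?thesis using False taft_monomial_high[of n q j] by (simp add: presented_class_eq_iff)
    qed
    then show ?thesis by (intro exI[of _ "\<lambda>i j. 0"]) (simp add: taft_normal_def)
  qed
qed



section \<open>Module algebras over the Taft algebra\<close>

lemma lin_linext_comp: "lin f \<Longrightarrow> f (linext b p) = linext (\<lambda>k. f (b k)) p"
  by (simp add: linext_def lin_sum lin_scale)

lemma linext_cong: "(\<And>k. k \<in> Poly_Mapping.keys p \<Longrightarrow> b k = b' k) \<Longrightarrow> linext b p = linext b' p"
  by (simp add: linext_def)

lemma linext_plus: "linext (\<lambda>k. b k + b' k) p = linext b p + linext b' p"
  by (simp add: linext_def scale_add_right sum.distrib)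

lemma linext_linext: "linext b (linext b' p) = linext (\<lambda>k. linext b (b' k)) p"
  by (rule lin_linext_comp[OF lin_linext])

lemma keys_scale: "Poly_Mapping.keys (scale c p) \<subseteq> Poly_Mapping.keys p"
  by (auto simp: in_keys_iff)

lemma keys_linext: "Poly_Mapping.keys (linext b p) \<subseteq> (\<Union>k\<in>Poly_Mapping.keys p. Poly_Mapping.keys (b k))"
proof
  fix i assume "i \<in> Poly_Mapping.keys (linext b p)"
  then have "(\<Sum>k\<in>Poly_Mapping.keys p. Poly_Mapping.lookup p k * Poly_Mapping.lookup (b k) i) \<noteq> 0"
    by (simp add: in_keys_iff linext_def lookup_sum)
  then obtain k where "k \<in> Poly_Mapping.keys p" "Poly_Mapping.lookup (b k) i \<noteq> 0"
    by (metis (no_types, lifting) mult_zero_right sum.neutral)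
  then show "i \<in> (\<Union>k\<in>Poly_Mapping.keys p. Poly_Mapping.keys (b k))" by (auto simp: in_keys_iff)
qed

lemma tensor_mult_linext:
  "tensor_mult A B s t = linext (\<lambda>k. linext (\<lambda>l.
    Poly_Mapping.single (fst k \<otimes>\<^bsub>A\<^esub> fst l, snd k \<otimes>\<^bsub>B\<^esub> snd l) 1) t) s"
  by (simp add: tensor_mult_def linext_def scale_sum)

lemma keys_tensor_mult:
  fixes s t :: "'a \<times> 'b \<Rightarrow>\<^sub>0 'k::field"
  shows "Poly_Mapping.keys (tensor_mult A B s t) \<subseteq>
    (\<lambda>(k, l). (fst k \<otimes>\<^bsub>A\<^esub> fst l, snd k \<otimes>\<^bsub>B\<^esub> snd l)) ` (Poly_Mapping.keys s \<times> Poly_Mapping.keys t)"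
proof
  fix i assume "i \<in> Poly_Mapping.keys (tensor_mult A B s t)"
  then obtain k where k: "k \<in> Poly_Mapping.keys s" and
    "i \<in> Poly_Mapping.keys (linext (\<lambda>l.
      Poly_Mapping.single (fst k \<otimes>\<^bsub>A\<^esub> fst l, snd k \<otimes>\<^bsub>B\<^esub> snd l) 1) t)"
    unfolding tensor_mult_linext using keys_linext by fast
  then obtain l where "l \<in> Poly_Mapping.keys t"
    "i \<in> Poly_Mapping.keys (Poly_Mapping.single (fst k \<otimes>\<^bsub>A\<^esub> fst l, snd k \<otimes>\<^bsub>B\<^esub> snd l) (1 :: 'k))"
    using keys_linext by fast
  then show "i \<in> (\<lambda>(k, l). (fst k \<otimes>\<^bsub>A\<^esub> fst l, snd k \<otimes>\<^bsub>B\<^esub> snd l)) `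
      (Poly_Mapping.keys s \<times> Poly_Mapping.keys t)"
    using k by (force simp: split: if_splits)
qed

text \<open>Universal property of the tensor product: a map that is bilinear on the carriers does
  not see the choice of a formal expansion.\<close>

lemma linext_tensor_null:
  fixes B :: "'a \<Rightarrow> 'b \<Rightarrow> ('j \<Rightarrow>\<^sub>0 'k::field)"
  assumes "t \<in> tensor_null A C"
    and "\<And>a a' b. a \<in> carrier A \<Longrightarrow> a' \<in> carrier A \<Longrightarrow> b \<in> carrier C \<Longrightarrow> B (a \<oplus>\<^bsub>A\<^esub> a') b = B a b + B a' b"
    and "\<And>a b b'. a \<in> carrier A \<Longrightarrow> b \<in> carrier C \<Longrightarrow> b' \<in> carrier C \<Longrightarrow> B a (b \<oplus>\<^bsub>C\<^esub> b') = B a b + B a b'"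
    and "\<And>c a b. a \<in> carrier A \<Longrightarrow> b \<in> carrier C \<Longrightarrow> B (c \<odot>\<^bsub>A\<^esub> a) b = scale c (B a b)"
    and "\<And>c a b. a \<in> carrier A \<Longrightarrow> b \<in> carrier C \<Longrightarrow> B a (c \<odot>\<^bsub>C\<^esub> b) = scale c (B a b)"
  shows "linext (\<lambda>k. B (fst k) (snd k)) t = 0"
  using assms(1)
  by induction
    (simp_all add: lin_zero[OF lin_linext] lin_add[OF lin_linext] lin_diff[OF lin_linext]
      assms(2-) scale_add_right)

section \<open>Structure maps of the Taft algebra and their action through operators\<close>

definition taft_delta ::
    "nat \<Rightarrow> 'k::field \<Rightarrow> taft_gen \<Rightarrow> (taft_gen, 'k) free_alg set \<times> (taft_gen, 'k) free_alg set \<Rightarrow>\<^sub>0 'k" where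
  "taft_delta n q a = (case a of
      Gen_g \<Rightarrow> Poly_Mapping.single (taft_g n q, taft_g n q) 1
    | Gen_x \<Rightarrow> Poly_Mapping.single (taft_g n q, taft_x n q) 1
             + Poly_Mapping.single (taft_x n q, taft_one n q) 1)"

lemma taft_delta_gen:
  "taft_delta n q Gen_g = Poly_Mapping.single (taft_g n q, taft_g n q) 1"
  "taft_delta n q Gen_x = Poly_Mapping.single (taft_g n q, taft_x n q) 1
    + Poly_Mapping.single (taft_x n q, taft_one n q) 1"
  by (simp_all add: taft_delta_def)

definition taft_eps :: "taft_gen \<Rightarrow> 'k::field" where
  "taft_eps a = (case a of Gen_g \<Rightarrow> 1 | Gen_x \<Rightarrow> 0)"

definition taft_anti :: "nat \<Rightarrow> taft_gen \<Rightarrow> (taft_gen, 'k::field) free_alg" where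
  "taft_anti n a = (case a of
      Gen_g \<Rightarrow> gen Gen_g ^ (n - 1)
    | Gen_x \<Rightarrow> - (gen Gen_g ^ (n - 1) * gen Gen_x))"

abbreviation taft_base where
  "taft_base n q \<equiv> presented_algebra (taft_rels n q)"

lemma taft_algebra_simps:
  "carrier (taft_algebra n q) = carrier (taft_base n q)"
  "mult (taft_algebra n q) = mult (taft_base n q)"
  "one (taft_algebra n q) = one (taft_base n q)"
  "zero (taft_algebra n q) = zero (taft_base n q)"
  "add (taft_algebra n q) = add (taft_base n q)"
  "smult (taft_algebra n q) = smult (taft_base n q)"
  "comult (taft_algebra n q) = (\<lambda>X. \<Union>p\<in>X. tensor_class (taft_base n q) (taft_base n q)
      (comult_free (taft_base n q) (taft_delta n q) p))"
  "counit (taft_algebra n q) = (\<lambda>X. the_elem (counit_free taft_eps ` X))"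
  "antipode (taft_algebra n q) = (\<lambda>X. \<Union>p\<in>X. taft_class n q (antipode_free (taft_anti n) p))"
  unfolding taft_algebra_def presented_hopf_algebra_def taft_delta_def [abs_def] taft_eps_def [abs_def]
    taft_anti_def [abs_def]
  by (simp_all add: Let_def module.defs hopf_algebra.defs)

abbreviation taft_delta_word where
  "taft_delta_word n q ws \<equiv> foldr (\<lambda>a. tensor_mult (taft_base n q) (taft_base n q) (taft_delta n q a)) ws
    (Poly_Mapping.single (\<one>\<^bsub>taft_base n q\<^esub>, \<one>\<^bsub>taft_base n q\<^esub>) 1)"

lemma comult_free_linext:
  "comult_free (taft_base n q) (taft_delta n q) = linext (\<lambda>w. taft_delta_word n q (letters w))"
  by (rule ext) (simp add: comult_free_def linext_def)

lemma tensor_class_representative: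
  "t \<in> tensor_class A B s \<Longrightarrow> \<exists>d\<in>tensor_null A B. t = s + d"
  by (auto simp: tensor_class_def intro!: bexI[of _ "t - s"])

lemma keys_taft_delta:
  "Poly_Mapping.keys (taft_delta n q a) \<subseteq> carrier (taft_base n q) \<times> carrier (taft_base n q)"
proof (cases a)
  case Gen_x
  then have "Poly_Mapping.keys (taft_delta n q a) \<subseteq>
      {(taft_g n q, taft_x n q), (taft_x n q, taft_one n q)}"
    using keys_add[of "Poly_Mapping.single (taft_g n q, taft_x n q) (1 :: 'a)"
        "Poly_Mapping.single (taft_x n q, taft_one n q) (1 :: 'a)"]
    by (simp add: taft_delta_def insert_commute)
  then show ?thesis by (auto simp: taft_g_def taft_x_def taft_one_def)
qed (auto simp: taft_delta_def taft_g_def)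

text \<open>Guarantees that every tensor factor in an expansion is a genuine coset, the only place
  where \<open>hrep\<close> is multiplicative.\<close>

lemma keys_taft_delta_word:
  "Poly_Mapping.keys (taft_delta_word n q ws) \<subseteq> carrier (taft_base n q) \<times> carrier (taft_base n q)"
proof (induction ws)
  case Nil
  then show ?case by (simp add: one_presented)
next
  case (Cons a ws)
  interpret H: ring "taft_base n q" by (rule ring_presented_algebra)
  show ?case
  proof
    fix k assume "k \<in> Poly_Mapping.keys (taft_delta_word n q (a # ws))"
    then obtain i j where "i \<in> Poly_Mapping.keys (taft_delta n q a)"
      "j \<in> Poly_Mapping.keys (taft_delta_word n q ws)"
      "k = (fst i \<otimes>\<^bsub>taft_base n q\<^esub> fst j, snd i \<otimes>\<^bsub>taft_base n q\<^esub> snd j)"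
      using keys_tensor_mult by fastforce
    then show "k \<in> carrier (taft_base n q) \<times> carrier (taft_base n q)"
      using keys_taft_delta[of n q a] Cons by (auto intro!: H.m_closed)
  qed
qed

text \<open>A Taft module algebra structure on a monoid algebra, described on the generators g and x
  alone. The axioms \<open>g_mult\<close> and \<open>x_mult\<close> transcribe the two coproducts;
  \<open>leibniz\<close> extends the product rule to every element.\<close>

locale taft_rep =
  fixes n :: nat and q :: "'k::field"
    and T :: "taft_gen \<Rightarrow> ('j::monoid_add \<Rightarrow>\<^sub>0 'k) \<Rightarrow> ('j \<Rightarrow>\<^sub>0 'k)"
  assumes lin_T: "lin (T a)"
    and g_power: "(T Gen_g ^^ n) m = m" and x_power: "(T Gen_x ^^ n) m = 0"
    and x_g: "T Gen_x (T Gen_g m) = scale q (T Gen_g (T Gen_x m))"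
    and g_mult: "T Gen_g (r * s) = T Gen_g r * T Gen_g s"
    and x_mult: "T Gen_x (r * s) = T Gen_g r * T Gen_x s + T Gen_x r * s"
    and g_one: "T Gen_g 1 = 1" and x_one: "T Gen_x 1 = 0"
begin

text \<open>Independent of the chosen representative when \<open>h\<close> is a class; junk otherwise.\<close>

definition hrep :: "(taft_gen, 'k) free_alg set \<Rightarrow> ('j \<Rightarrow>\<^sub>0 'k) \<Rightarrow> ('j \<Rightarrow>\<^sub>0 'k)" where
  "hrep h = rep T (SOME p. p \<in> h)"

lemma rep_rels: "p \<in> rel_ideal (taft_rels n q) \<Longrightarrow> rep T p m = 0"
  by (rule rep_taft_rel_ideal[OF lin_T g_power x_power x_g])

lemma hrep_class [simp]: "hrep (taft_class n q p) = rep T p"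
proof
  fix m
  have "(SOME r. r \<in> taft_class n q p) \<in> taft_class n q p"
    by (rule someI[of "\<lambda>r. r \<in> taft_class n q p" p]) simp
  then have "rep T ((SOME r. r \<in> taft_class n q p) - p) m = 0"
    by (intro rep_rels) (simp add: mem_presented_class)
  then show "hrep (taft_class n q p) m = rep T p m" by (simp add: hrep_def rep_diff_left)
qed

lemma lin_hrep: "lin (hrep h)"
  unfolding hrep_def by (rule lin_rep[OF lin_T])

lemma hrep_add: "h \<in> carrier (taft_base n q) \<Longrightarrow> h' \<in> carrier (taft_base n q) \<Longrightarrow>
    hrep (h \<oplus>\<^bsub>taft_base n q\<^esub> h') m = hrep h m + hrep h' m"
  by (auto simp: carrier_presented rep_add_left)

lemma hrep_smult: "h \<in> carrier (taft_base n q) \<Longrightarrow>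
    hrep (c \<odot>\<^bsub>taft_base n q\<^esub> h) m = scale c (hrep h m)"
  by (auto simp: carrier_presented rep_scale_left)

lemma hrep_mult: "h \<in> carrier (taft_base n q) \<Longrightarrow> h' \<in> carrier (taft_base n q) \<Longrightarrow>
    hrep (h \<otimes>\<^bsub>taft_base n q\<^esub> h') m = hrep h (hrep h' m)"
  by (auto simp: carrier_presented rep_mult[OF lin_T])

lemma taft_gen_closed: "taft_g n q \<in> carrier (taft_base n q)" "taft_x n q \<in> carrier (taft_base n q)"
  "taft_one n q \<in> carrier (taft_base n q)"
  by (simp_all add: taft_g_def taft_x_def taft_one_def)

lemma hrep_gen: "hrep (taft_g n q) = T Gen_g" "hrep (taft_x n q) = T Gen_x" "hrep (taft_one n q) = (\<lambda>m. m)"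
  by (simp_all add: taft_g_def taft_x_def taft_one_def fun_eq_iff)

abbreviation tensor_act :: "('j \<Rightarrow>\<^sub>0 'k) \<Rightarrow> ('j \<Rightarrow>\<^sub>0 'k) \<Rightarrow>
    ((taft_gen, 'k) free_alg set \<times> (taft_gen, 'k) free_alg set \<Rightarrow>\<^sub>0 'k) \<Rightarrow> ('j \<Rightarrow>\<^sub>0 'k)" where
  "tensor_act r s \<equiv> linext (\<lambda>k. hrep (fst k) r * hrep (snd k) s)"

lemma tensor_act_mult:
  assumes "Poly_Mapping.keys t \<subseteq> carrier (taft_base n q) \<times> carrier (taft_base n q)"
    "h \<in> carrier (taft_base n q)" "h' \<in> carrier (taft_base n q)"
  shows "tensor_act r s (linext (\<lambda>l. Poly_Mapping.single
      (h \<otimes>\<^bsub>taft_base n q\<^esub> fst l, h' \<otimes>\<^bsub>taft_base n q\<^esub> snd l) 1) t) =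
    linext (\<lambda>k. hrep h (hrep (fst k) r) * hrep h' (hrep (snd k) s)) t"
  unfolding linext_linext using assms by (intro linext_cong) (auto simp: hrep_mult)

text \<open>Putting a letter in front of a word multiplies its coproduct by
  \<open>taft_delta\<close>, and by \<open>g_mult\<close> or \<open>x_mult\<close> this amounts to
  applying the operator of that letter to the product.\<close>

lemma tensor_act_word: "tensor_act r s (taft_delta_word n q ws) = foldr T ws (r * s)"
proof (induction ws)
  case Nil
  then show ?case by (simp add: one_presented)
next
  case (Cons a ws)
  let ?t = "taft_delta_word n q ws"
  note keys = keys_taft_delta_word[of n q ws]
  have "tensor_act r s (taft_delta_word n q (a # ws)) = T a (tensor_act r s ?t)"
  proof (cases a)
    case Gen_g
    then show ?thesis
      by (simp add: tensor_mult_linext taft_delta_gen tensor_act_mult[OF keys] taft_gen_closed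
          hrep_gen lin_linext_comp[OF lin_T] g_mult)
  next
    case Gen_x
    then show ?thesis
      by (simp add: tensor_mult_linext taft_delta_gen lin_add[OF lin_linext] tensor_act_mult[OF keys]
          taft_gen_closed hrep_gen lin_linext_comp[OF lin_T] x_mult linext_plus)
  qed
  then show ?case using Cons by simp
qed

text \<open>An expansion \<open>t\<close> of the coproduct involves two choices, a representative of
  the class and an element of \<open>tensor_null\<close>. The first is harmless by the Taft
  relations, the second by bilinearity.\<close>

lemma leibniz:
  assumes "t \<in> comult (taft_algebra n q) (taft_class n q p)"
  shows "rep T p (r * s) = tensor_act r s t"
proof -
  obtain p' where p': "p' \<in> taft_class n q p"
    and "t \<in> tensor_class (taft_base n q) (taft_base n q) (comult_free (taft_base n q) (taft_delta n q) p')"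
    using assms by (auto simp: taft_algebra_simps)
  then obtain d where d: "d \<in> tensor_null (taft_base n q) (taft_base n q)"
    and t: "t = comult_free (taft_base n q) (taft_delta n q) p' + d"
    using tensor_class_representative by blast
  have "tensor_act r s d = 0"
    by (rule linext_tensor_null[OF d])
      (simp_all add: hrep_add hrep_smult distrib_left distrib_right)
  moreover have "tensor_act r s (comult_free (taft_base n q) (taft_delta n q) p') = rep T p' (r * s)"
    by (simp add: comult_free_linext linext_linext tensor_act_word rep_def)
  moreover have "rep T p' (r * s) = rep T p (r * s)"
    using p' hrep_class presented_class_eqI by metis
  ultimately show ?thesis by (simp add: t lin_add[OF lin_linext])
qed

end

text \<open>A common eigenvector of all generators spans a one-dimensional representation, and its
  character is the counit. It is applied both to an abstract line and to the unit of the free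
  algebra.\<close>

lemma rep_counit_free:
  assumes "\<And>a. lin (T a)" "\<And>a. T a m = scale (e a) m"
  shows "rep T p m = scale (counit_free e p) m"
proof -
  have "foldr T ws m = scale (prod_list (map e ws)) m" for ws
    by (induction ws) (simp_all add: lin_scale[OF assms(1)] assms(2) mult.commute)
  moreover have "scale (\<Sum>i\<in>I. f i) m = (\<Sum>i\<in>I. scale (f i) m)" for I :: "'a fword set" and f
    by (induction I rule: infinite_finite_induct) (simp_all add: scale_add_left)
  ultimately show ?thesis by (simp add: rep_def linext_def counit_free_def)
qed

lemma counit_taft_class:
  assumes "n > 0"
  shows "counit (taft_algebra n q) (taft_class n q p) = counit_free taft_eps p"
proof -
  \<comment> \<open>The trivial one-dimensional module, realised on functions on
    \<open>unit\<close>. The Taft relations hold on it (0^n = 0 uses n > 0), so the counit is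
    constant on cosets and \<open>the_elem\<close> is meaningful.\<close>
  define T :: "taft_gen \<Rightarrow> (unit \<Rightarrow>\<^sub>0 'a) \<Rightarrow> (unit \<Rightarrow>\<^sub>0 'a)" where "T a = scale (taft_eps a)" for a
  have lin: "lin (T a)" for a
    unfolding T_def by (intro lin_scaled lin_id)
  have pow: "(T a ^^ k) m = scale (taft_eps a ^ k) m" for a k m
    by (induction k) (simp_all add: T_def)
  have T_simps: "T Gen_g m = m" "T Gen_x m = 0" for m
    by (simp_all add: T_def taft_eps_def)
  have *: "rep T r m = scale (counit_free taft_eps r) m" for r m
    by (rule rep_counit_free[OF lin]) (simp add: T_def)
  have "counit_free taft_eps r = counit_free taft_eps p" if "r \<in> taft_class n q p" for r
  proof -
    let ?m = "Poly_Mapping.single () (1 :: 'a)"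
    have "rep T (r - p) ?m = 0"
      by (rule rep_taft_rel_ideal[OF lin])
        (use that assms in \<open>simp_all add: pow T_simps taft_eps_def mem_presented_class power_0_left\<close>)
    then have "Poly_Mapping.single () (counit_free taft_eps r) = Poly_Mapping.single () (counit_free taft_eps p)"
      by (simp add: rep_diff_left *)
    then show ?thesis by (metis lookup_single_eq)
  qed
  then have "counit_free taft_eps ` taft_class n q p = {counit_free taft_eps p}"
    using presented_class_self by blast
  then show ?thesis by (simp add: taft_algebra_simps)
qed

section \<open>Descent of the operators to a quotient\<close>

locale taft_plane_action = taft_rep n q T for n q and T :: "taft_gen \<Rightarrow> ('x, 'k::field) free_alg \<Rightarrow> _" +
  fixes R :: "('x, 'k) free_alg set"
  assumes n_pos: "n > 0" and stable_rel: "r \<in> R \<Longrightarrow> T a r \<in> rel_ideal R"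
begin

lemma stable_T: 
  assumes "p \<in> rel_ideal R"
  shows "T a p \<in> rel_ideal R"
proof -
  \<comment> \<open>Membership of \<open>p\<close> itself is carried along, since the skew product
    rule produces a term in which \<open>p\<close> is left untouched.\<close>
  have "p \<in> rel_ideal R \<and> (\<forall>a. T a p \<in> rel_ideal R)"
    using assms
  proof (induction p rule: rel_ideal_induct)
    case (left p r)
    have "T a (r * p) \<in> rel_ideal R" for a
      using left by (cases a) (auto simp: g_mult x_mult intro!: rel_ideal_add rel_ideal_mult_left)
    then show ?case using left by (simp add: rel_ideal_mult_left)
  next
    case (right p r)
    have "T a (p * r) \<in> rel_ideal R" for a
      using right by (cases a) (auto simp: g_mult x_mult intro!: rel_ideal_add rel_ideal_mult_right)
    then show ?case using right by (simp add: rel_ideal_mult_right)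
  qed (simp_all add: rel_ideal_base stable_rel rel_ideal_add lin_zero[OF lin_T] lin_add[OF lin_T])
  then show ?thesis by simp
qed

lemma stable_rep:
  assumes "r \<in> rel_ideal R"
  shows "rep T p r \<in> rel_ideal R"
proof (induction p rule: poly_mapping_linear_induct)
  case (single w c)
  have "foldr T ws r \<in> rel_ideal R" for ws by (induction ws) (simp_all add: assms stable_T)
  then show ?case by (simp add: rep_single rel_ideal_scale)
qed (simp_all add: rep_zero_left rep_add_left rel_ideal_add)

definition act :: "(taft_gen, 'k) free_alg set \<Rightarrow> ('x, 'k) free_alg set \<Rightarrow> ('x, 'k) free_alg set" where
  "act h a = presented_class R (hrep h (SOME r. r \<in> a))"

lemma act_class: "act h (presented_class R r) = presented_class R (hrep h r)"
proof -
  have "(SOME s. s \<in> presented_class R r) \<in> presented_class R r"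
    by (rule someI[of "\<lambda>s. s \<in> presented_class R r" r]) simp
  then have "hrep h ((SOME s. s \<in> presented_class R r) - r) \<in> rel_ideal R"
    unfolding hrep_def by (intro stable_rep) (simp add: mem_presented_class)
  then show ?thesis by (simp add: act_def presented_class_eq_iff lin_diff[OF lin_hrep])
qed

lemma act_on_mult:
  assumes "t \<in> comult (taft_algebra n q) (taft_class n q p)"
  shows "presented_class R (rep T p (r * s)) =
    (\<Oplus>\<^bsub>presented_algebra R\<^esub>k\<in>Poly_Mapping.keys t. Poly_Mapping.lookup t k \<odot>\<^bsub>presented_algebra R\<^esub>
      (act (fst k) (presented_class R r) \<otimes>\<^bsub>presented_algebra R\<^esub> act (snd k) (presented_class R s)))"
  by (simp add: act_class finsum_presented leibniz[OF assms] linext_def)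

lemma hopf_action_act: "hopf_action (taft_algebra n q) (presented_algebra R) act"
proof
  fix h r r' t
  assume "h \<in> carrier (taft_algebra n q)" "r \<in> carrier (presented_algebra R)"
    "r' \<in> carrier (presented_algebra R)" "t \<in> comult (taft_algebra n q) h"
  moreover from this obtain p s s' where "h = taft_class n q p"
    "r = presented_class R s" "r' = presented_class R s'"
    by (auto simp: taft_algebra_simps(1) carrier_presented)
  ultimately show "act h (r \<otimes>\<^bsub>presented_algebra R\<^esub> r') =
    (\<Oplus>\<^bsub>presented_algebra R\<^esub>p\<in>Poly_Mapping.keys t. Poly_Mapping.lookup t p \<odot>\<^bsub>presented_algebra R\<^esub>
      (act (fst p) r \<otimes>\<^bsub>presented_algebra R\<^esub> act (snd p) r'))"
    using act_on_mult[of t p s s'] by (simp only: mult_presented act_class[of _ "s * s'"] hrep_class)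
next
  fix h assume "h \<in> carrier (taft_algebra n q)"
  then obtain p where p: "h = taft_class n q p" by (auto simp: taft_algebra_simps(1) carrier_presented)
  have "rep T p 1 = scale (counit_free taft_eps p) 1"
    by (rule rep_counit_free[OF lin_T])
      (simp add: taft_eps_def g_one x_one split: taft_gen.split)
  then show "act h \<one>\<^bsub>presented_algebra R\<^esub> =
      counit (taft_algebra n q) h \<odot>\<^bsub>presented_algebra R\<^esub> \<one>\<^bsub>presented_algebra R\<^esub>"
    by (simp add: p one_presented act_class counit_taft_class n_pos)
qed (auto simp: taft_algebra_simps(1-6) carrier_presented act_class one_presented
    rep_add_left rep_scale_left rep_mult[OF lin_T] lin_add[OF lin_rep[OF lin_T]]
    lin_scale[OF lin_rep[OF lin_T]])

end



section \<open>The skew derivation of the free algebra\<close>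

lemma single_Word_Nil: "Poly_Mapping.single (Word []) 1 = 1"
  by (simp add: zero_fword_def flip: single_one)

lemma free_alg_induct [case_names one gen_mult add scale]:
  fixes P :: "('x, 'k::field) free_alg \<Rightarrow> bool"
  assumes one: "P 1" and gen_mult: "\<And>a r. P r \<Longrightarrow> P (gen a * r)"
    and add: "\<And>p r. P p \<Longrightarrow> P r \<Longrightarrow> P (p + r)" and scale: "\<And>c p. P p \<Longrightarrow> P (scale c p)"
  shows "P p"
proof (induction p rule: poly_mapping_linear_induct)
  case (single w c)
  have "P (Poly_Mapping.single (Word ws) 1)" for ws
  proof (induction ws)
    case Nil
    then show ?case using one by (simp add: single_Word_Nil)
  next
    case (Cons a ws)
    then show ?case unfolding single_word_Cons by (rule gen_mult)
  qed
  from scale[OF this, of c "letters w"] show ?case by simp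
qed (use scale[OF one, of 0] add in simp_all)

lemma lookup_gen_mult:
  "Poly_Mapping.lookup (gen a * r) (Word (b # ws)) = (if a = b then Poly_Mapping.lookup r (Word ws) else 0)"
proof (induction r rule: poly_mapping_linear_induct)
  case (single w c)
  then show ?case by (cases w) (simp add: gen_def mult_single plus_fword_def lookup_single when_def)
qed (simp_all add: distrib_left lookup_add)

lemma count_list_replicate: "count_list (replicate k a) b = (if a = b then k else 0)"
  by (induction k) (auto split: if_splits)

lemma keys_gen_mult:
  "w \<in> Poly_Mapping.keys (gen a * r) \<Longrightarrow> \<exists>z\<in>Poly_Mapping.keys r. letters w = a # letters z"
  using keys_mult[of "gen a" r] by (force simp: gen_def plus_fword_def split: if_splits)

text \<open>Vandermonde in polynomial form: degree less than n, but the n distinct roots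
  q^b.\<close>

lemma vanishing_of_root_powers:
  fixes q :: "'k::field"
  assumes q: "has_mult_order q n" and "\<And>b. b < n \<Longrightarrow> (\<Sum>i<n. f i * (q ^ b) ^ i) = 0" and "i < n"
  shows "f i = 0"
proof -
  define p where "p = (\<Sum>i<n. monom (f i) i)"
  have coeff: "coeff p k = (if k < n then f k else 0)" for k
    by (simp add: p_def coeff_sum sum.delta)
  have inj: "inj_on (\<lambda>b. q ^ b) {..<n}"
  proof (rule linorder_inj_onI)
    fix a b assume ab: "a < b" "a \<in> {..<n}" "b \<in> {..<n}"
    show "q ^ a \<noteq> q ^ b"
    proof
      assume "q ^ a = q ^ b"
      moreover have "q ^ b = q ^ a * q ^ (b - a)" using ab by (simp flip: power_add)
      moreover have "q \<noteq> 0" using q by (auto simp: has_mult_order_def power_0_left)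
      ultimately have "q ^ (b - a) = 1" by simp
      then show False using q ab by (auto simp: has_mult_order_def)
    qed
  qed auto
  have "p = 0"
  proof (rule ccontr)
    assume "p \<noteq> 0"
    have "(\<lambda>b. q ^ b) ` {..<n} \<subseteq> {x. poly p x = 0}"
      using assms(2) by (auto simp: p_def poly_sum poly_monom)
    then have "n \<le> card {x. poly p x = 0}"
      using card_mono[OF poly_roots_finite[OF \<open>p \<noteq> 0\<close>], of "(\<lambda>b. q ^ b) ` {..<n}"]
      by (simp add: card_image[OF inj])
    also have "\<dots> \<le> degree p" by (rule card_poly_roots_bound[OF \<open>p \<noteq> 0\<close>])
    also have "degree p < n"
      using \<open>i < n\<close> \<open>p \<noteq> 0\<close> coeff[of "degree p"] by (auto split: if_splits)
    finally show False by simp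
  qed
  then show ?thesis using coeff[of i] \<open>i < n\<close> by simp
qed

text \<open>\<open>c\<close> is the generator killed by x and \<open>d\<close> the one sent to
  \<eta> c; \<alpha> is the eigenvalue of g on \<open>c\<close>. The eigenvalue of g on
  \<open>d\<close> must then be q \<alpha>, because xg = q gx is to hold on \<open>d\<close>.
  Leaving \<open>c\<close> and \<open>d\<close> open covers both families at once.\<close>

locale skew_derivation =
  fixes n :: nat and q \<alpha> \<eta> :: "'k::field_char_0" and c d :: plane_gen
  assumes n_gt: "n > 1" and q_order: "has_mult_order q n" and \<alpha>_power: "\<alpha> ^ n = 1"
    and \<eta>_nonzero: "\<eta> \<noteq> 0" and c_neq_d: "c \<noteq> d"
begin

definition weight :: "plane_gen fword \<Rightarrow> 'k" where
  "weight w = prod_list (map (\<lambda>a. if a = c then \<alpha> else q * \<alpha>) (letters w))"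

definition G :: "(plane_gen, 'k) free_alg \<Rightarrow> (plane_gen, 'k) free_alg" where
  "G = linext (\<lambda>w. Poly_Mapping.single w (weight w))"

text \<open>The recursion is the skew product rule X(a r) = G(a) X(r) + X(a) r with a the first
  letter.\<close>

fun X_word :: "plane_gen list \<Rightarrow> (plane_gen, 'k) free_alg" where
  "X_word [] = 0"
| "X_word (a # ws) = (if a = c then scale \<alpha> (gen c * X_word ws)
     else scale (q * \<alpha>) (gen d * X_word ws) + scale \<eta> (gen c * Poly_Mapping.single (Word ws) 1))"

definition X :: "(plane_gen, 'k) free_alg \<Rightarrow> (plane_gen, 'k) free_alg" where
  "X = linext (\<lambda>w. X_word (letters w))"

definition T :: "taft_gen \<Rightarrow> (plane_gen, 'k) free_alg \<Rightarrow> (plane_gen, 'k) free_alg" where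
  "T a = (case a of Gen_g \<Rightarrow> G | Gen_x \<Rightarrow> X)"

lemma T_simps: "T Gen_g = G" "T Gen_x = X"
  by (simp_all add: T_def)

lemma lin_G: "lin G" and lin_X: "lin X"
  by (simp_all add: G_def X_def lin_linext)

lemmas G_lin_simps = lin_add[OF lin_G] lin_scale[OF lin_G] lin_zero[OF lin_G]
lemmas X_lin_simps = lin_add[OF lin_X] lin_scale[OF lin_X] lin_zero[OF lin_X]

lemma gen_cases: "a = c \<or> a = d" for a
  using c_neq_d by (cases a; cases c; cases d) auto

lemma gen_mult_single: "gen a * Poly_Mapping.single w e = Poly_Mapping.single (Word (a # letters w)) e"
  by (simp add: gen_def mult_single plus_fword_def)

lemma G_one: "G 1 = 1"
  by (simp add: G_def weight_def zero_fword_def flip: single_one)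

lemma X_one: "X 1 = 0"
  by (simp add: X_def zero_fword_def flip: single_one)

lemma G_gen_mult:
  "G (gen c * r) = scale \<alpha> (gen c * G r)"
  "G (gen d * r) = scale (q * \<alpha>) (gen d * G r)"
proof -
  have "G (gen a * r) = scale (if a = c then \<alpha> else q * \<alpha>) (gen a * G r)" for a
  proof (induction r rule: poly_mapping_linear_induct)
    case (single w e)
    then show ?case by (simp add: gen_mult_single G_def weight_def mult_ac)
  qed (simp_all add: G_lin_simps distrib_left scale_add_right)
  from this[of c] this[of d] show "G (gen c * r) = scale \<alpha> (gen c * G r)"
    "G (gen d * r) = scale (q * \<alpha>) (gen d * G r)"
    using c_neq_d by simp_all
qed

lemma X_gen_mult:
  "X (gen c * r) = scale \<alpha> (gen c * X r)"
  "X (gen d * r) = scale (q * \<alpha>) (gen d * X r) + scale \<eta> (gen c * r)"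
proof -
  show "X (gen c * r) = scale \<alpha> (gen c * X r)"
  proof (induction r rule: poly_mapping_linear_induct)
    case (single w e)
    then show ?case by (simp add: gen_mult_single X_def mult.commute)
  qed (simp_all add: X_lin_simps distrib_left scale_add_right)
  show "X (gen d * r) = scale (q * \<alpha>) (gen d * X r) + scale \<eta> (gen c * r)"
  proof (induction r rule: poly_mapping_linear_induct)
    case (single w e)
    then show ?case using c_neq_d
      by (simp add: gen_mult_single X_def scale_add_right mult.commute)
  qed (simp_all add: X_lin_simps distrib_left scale_add_right)
qed

lemma G_gen: "G (gen c) = scale \<alpha> (gen c)" "G (gen d) = scale (q * \<alpha>) (gen d)"
  using G_gen_mult[of 1] by (simp_all add: G_one)

lemma X_gen: "X (gen c) = 0" "X (gen d) = scale \<eta> (gen c)"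
  using X_gen_mult[of 1] by (simp_all add: X_one)

lemma G_mult: "G (r * s) = G r * G s"
proof (induction r rule: free_alg_induct)
  case (gen_mult a r)
  then show ?case using gen_cases[of a] by (auto simp: G_gen_mult mult.assoc)
qed (simp_all add: G_one G_lin_simps distrib_right)

lemma X_mult: "X (r * s) = G r * X s + X r * s"
proof (induction r rule: free_alg_induct)
  case (gen_mult a r)
  then show ?case using gen_cases[of a]
    by (auto simp: G_gen_mult X_gen_mult mult.assoc distrib_left distrib_right scale_add_right)
qed (simp_all add: G_one X_one G_lin_simps X_lin_simps distrib_right scale_add_right)

lemma X_G: "X (G m) = scale q (G (X m))"
proof (induction m rule: free_alg_induct)
  case (gen_mult a r)
  then show ?case using gen_cases[of a]
    by (auto simp: G_gen_mult X_gen_mult G_lin_simps X_lin_simps scale_add_right mult_ac)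
qed (simp_all add: G_one X_one G_lin_simps X_lin_simps scale_add_right mult.commute)

lemma q_power: "q ^ n = 1"
  using q_order by (simp add: has_mult_order_def)

lemma G_funpow_gen_mult:
  "(G ^^ k) (gen c * r) = scale (\<alpha> ^ k) (gen c * (G ^^ k) r)"
  "(G ^^ k) (gen d * r) = scale ((q * \<alpha>) ^ k) (gen d * (G ^^ k) r)"
  by (induction k) (simp_all add: G_lin_simps G_gen_mult mult.commute)

lemma G_power: "(G ^^ n) m = m"
proof (induction m rule: free_alg_induct)
  case one
  have "(G ^^ k) 1 = 1" for k by (induction k) (simp_all add: G_one)
  then show ?case .
next
  case (gen_mult a r)
  then show ?case using gen_cases[of a]
    by (auto simp: G_funpow_gen_mult \<alpha>_power q_power power_mult_distrib)
qed (simp_all add: lin_add[OF lin_funpow[OF lin_G]] lin_scale[OF lin_funpow[OF lin_G]])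

section \<open>Powers of \<open>X\<close> and Gaussian integers\<close>

definition qnum :: "nat \<Rightarrow> 'k" where
  "qnum k = (\<Sum>i<k. q ^ i)"

lemma X_funpow_c: "(X ^^ k) (gen c * r) = scale (\<alpha> ^ k) (gen c * (X ^^ k) r)"
  by (induction k) (simp_all add: X_lin_simps X_gen_mult mult.commute)

text \<open>Stated for \<open>Suc k\<close> to avoid a truncated exponent k - 1 in the second
  term.\<close>

lemma X_funpow_d: "(X ^^ Suc k) (gen d * r) =
    scale ((q * \<alpha>) ^ Suc k) (gen d * (X ^^ Suc k) r) +
    scale (\<eta> * \<alpha> ^ k * qnum (Suc k)) (gen c * (X ^^ k) r)"
proof (induction k)
  case 0
  then show ?case by (simp add: X_gen_mult qnum_def)
next
  case (Suc k)
  have "(X ^^ Suc (Suc k)) (gen d * r) = X ((X ^^ Suc k) (gen d * r))" by simp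
  also have "\<dots> = scale ((q * \<alpha>) ^ Suc (Suc k)) (gen d * (X ^^ Suc (Suc k)) r) +
      (scale ((q * \<alpha>) ^ Suc k * \<eta>) (gen c * (X ^^ Suc k) r) +
       scale (\<eta> * \<alpha> ^ k * qnum (Suc k) * \<alpha>) (gen c * (X ^^ Suc k) r))"
    unfolding Suc by (simp add: X_lin_simps X_gen_mult scale_add_right mult_ac)
  \<comment> \<open>One contribution comes from \<open>X\<close> hitting the leading
    \<open>d\<close>, the other from \<open>X\<close> passing a \<open>c\<close> produced earlier.
    They combine through [k+2]_q = [k+1]_q + q^(k+1).\<close>
  also have "scale ((q * \<alpha>) ^ Suc k * \<eta>) (gen c * (X ^^ Suc k) r) +
       scale (\<eta> * \<alpha> ^ k * qnum (Suc k) * \<alpha>) (gen c * (X ^^ Suc k) r) =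
      scale (\<eta> * \<alpha> ^ Suc k * qnum (Suc (Suc k))) (gen c * (X ^^ Suc k) r)"
    unfolding scale_add_left [symmetric]
    by (rule arg_cong[of _ _ "\<lambda>t. scale t _"]) (simp add: qnum_def algebra_simps power_mult_distrib)
  finally show ?case .
qed

lemma q_neq_1: "q \<noteq> 1"
  using q_order n_gt by (auto simp: has_mult_order_def)

lemma qnum_n: "qnum n = 0"
  unfolding qnum_def using geometric_sum[OF q_neq_1, of n] q_power by simp

lemma qnum_nonzero: "0 < k \<Longrightarrow> k < n \<Longrightarrow> qnum k \<noteq> 0"
  unfolding qnum_def using geometric_sum[OF q_neq_1, of k] q_order q_neq_1
  by (auto simp: has_mult_order_def)

text \<open>Since \<open>[n]\<^sub>q = 0\<close>, the operator \<open>X\<^sup>n\<close> commutes with left multiplication by letters up to scalars.\<close>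

lemma X_power: "(X ^^ n) m = 0"
proof (induction m rule: free_alg_induct)
  case one
  have "(X ^^ k) 0 = 0" for k by (induction k) (simp_all add: X_lin_simps)
  then show ?case using n_gt by (cases n) (simp_all add: funpow_swap1 X_one del: funpow.simps add: funpow_Suc_right)
next
  case (gen_mult a r)
  have "(X ^^ n) (gen d * r) = scale ((q * \<alpha>) ^ n) (gen d * (X ^^ n) r)"
    using X_funpow_d[of "n - 1" r] n_gt qnum_n by simp
  then show ?case using gen_cases[of a] gen_mult by (auto simp: X_funpow_c)
qed (simp_all add: lin_add[OF lin_funpow[OF lin_X]] lin_scale[OF lin_funpow[OF lin_X]])

sublocale taft_rep n q T
proof
  show "lin (T a)" for a by (cases a) (simp_all add: T_simps lin_G lin_X)
qed (simp_all add: T_simps G_power X_power X_G G_mult X_mult G_one X_one)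

section \<open>Faithfulness on the free algebra\<close>

lemma lookup_G_funpow: "Poly_Mapping.lookup ((G ^^ i) r) w = weight w ^ i * Poly_Mapping.lookup r w"
proof (induction i)
  case (Suc i)
  have "Poly_Mapping.lookup (G s) w = weight w * Poly_Mapping.lookup s w" for s
    by (induction s rule: poly_mapping_linear_induct)
      (simp_all add: G_lin_simps lookup_add distrib_left, simp add: G_def lookup_single when_def)
  then show ?case using Suc by simp
qed simp

text \<open>\<open>X\<close> is homogeneous of degree -1 for the grading by the number of letters
  \<open>d\<close>: each term of the product rule replaces exactly one \<open>d\<close> by
  \<open>c\<close>.\<close>

lemma keys_X_word: "w \<in> Poly_Mapping.keys (X_word ws) \<Longrightarrow>
    Suc (count_list (letters w) d) = count_list ws d"
proof (induction ws arbitrary: w)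
  case (Cons a ws)
  show ?case
  proof (cases "a = c")
    case True
    then have "w \<in> Poly_Mapping.keys (gen c * X_word ws)" using Cons.prems by (auto dest: subsetD[OF keys_scale])
    then show ?thesis using keys_gen_mult Cons.IH True c_neq_d by fastforce
  next
    case False
    then have "w \<in> Poly_Mapping.keys (gen d * X_word ws) \<or>
        w \<in> Poly_Mapping.keys (gen c * Poly_Mapping.single (Word ws) (1 :: 'k))"
      using Cons.prems keys_scale keys_add by (fastforce simp del: mult_scale_right)
    then show ?thesis using False gen_cases[of a] c_neq_d keys_gen_mult Cons.IH
      by (fastforce simp: gen_mult_single)
  qed
qed simp

lemma keys_X_funpow: "w \<in> Poly_Mapping.keys ((X ^^ k) r) \<Longrightarrow>
    \<exists>z\<in>Poly_Mapping.keys r. count_list (letters w) d + k = count_list (letters z) d"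
proof (induction k arbitrary: w)
  case (Suc k)
  then obtain z where "z \<in> Poly_Mapping.keys ((X ^^ k) r)" "w \<in> Poly_Mapping.keys (X_word (letters z))"
    using keys_linext[of "\<lambda>w. X_word (letters w)" "(X ^^ k) r"] by (auto simp: X_def)
  from keys_X_word[OF this(2)] Suc.IH[OF this(1)] show ?case by force
qed auto

text \<open>In closed form \<eta>^j \<alpha>^(j(j-1)/2) times the Gaussian factorial of j: the
  product of the coefficients with which \<open>X_funpow_d\<close> turns a leading \<open>d\<close>
  into \<open>c\<close>.\<close>

definition leading :: "nat \<Rightarrow> 'k" where
  "leading j = (\<Prod>i<j. \<eta> * \<alpha> ^ i * qnum (Suc i))"

text \<open>The factors are [1]_q, ..., [j]_q with j < n, none of which vanishes because the order
  of q is exactly n.\<close>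

lemma leading_nonzero: "j < n \<Longrightarrow> leading j \<noteq> 0"
  using \<eta>_nonzero \<alpha>_power n_gt qnum_nonzero by (auto simp: leading_def power_0_left)

text \<open>Only the terms in which \<open>X\<close> hits each of the first \<open>j\<close> letters once contribute, so the coefficient does not
  depend on what follows; on \<open>A\<close> the contributions of different words could cancel.\<close>

lemma lookup_X_funpow:
  "Poly_Mapping.lookup ((X ^^ j) (gen d ^ j * r)) (Word (replicate j c @ zs)) =
    leading j * Poly_Mapping.lookup r (Word zs)"
proof (induction j)
  case (Suc j)
  have "gen d ^ Suc j * r = gen d * (gen d ^ j * r)" by (simp add: mult.assoc)
  then have "Poly_Mapping.lookup ((X ^^ Suc j) (gen d ^ Suc j * r)) (Word (replicate (Suc j) c @ zs)) =
    (\<eta> * \<alpha> ^ j * qnum (Suc j)) *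
      Poly_Mapping.lookup ((X ^^ j) (gen d ^ j * r)) (Word (replicate j c @ zs))"
    using c_neq_d by (simp only: X_funpow_d) (simp add: lookup_add lookup_gen_mult del: funpow.simps)
  then show ?case unfolding Suc by (simp add: leading_def)
qed (simp add: leading_def)

lemma gen_power_mult_single:
  "gen a ^ k * Poly_Mapping.single (Word ws) e = Poly_Mapping.single (Word (replicate k a @ ws)) e"
  by (induction k) (simp_all add: mult.assoc gen_mult_single)

lemma rep_taft_normal:
  "rep T (taft_normal n f) m = (\<Sum>j<n. \<Sum>i<n. scale (f i j) ((G ^^ i) ((X ^^ j) m)))"
proof -
  have [simp]: "rep T (gen a) = T a" for a by (rule ext) simp
  show ?thesis
    by (simp add: taft_normal_def lin_sum[OF lin_rep_left] rep_scale_left rep_mult[OF lin_T]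
        rep_power[OF lin_T] T_simps)
qed

text \<open>Apply the normal form to d^j followed by \<open>zs\<close> and read the coefficient of
  c^j followed by \<open>zs\<close>. Only the power j of x contributes, and the n choices of b give
  a Vandermonde system for the coefficients of the powers of g.\<close>

lemma taft_normal_faithful:
  assumes "\<And>m. rep T (taft_normal n f) m = 0" and ij: "i < n" "j < n"
  shows "f i j = 0"
proof (rule vanishing_of_root_powers[OF q_order _ ij(1), of "\<lambda>i. f i j"])
  fix b assume "b < n"
  \<comment> \<open>The b letters \<open>d\<close> give the target word weight q^b. The trailing
    letters \<open>c\<close> pad its length j + b to n (j + b), so that all powers of \<alpha>
    cancel by \<alpha>^n = 1.\<close>
  define zs where "zs = replicate b d @ replicate ((n - 1) * (j + b)) c"
  define r where "r = Poly_Mapping.single (Word zs) (1 :: 'k)"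
  define w where "w = Word (replicate j c @ zs)"
  have count_w: "count_list (letters w) d = b"
    using c_neq_d by (simp add: w_def zs_def count_list_append count_list_replicate)
  have start: "gen d ^ j * r = Poly_Mapping.single (Word (replicate j d @ zs)) 1"
    by (simp add: r_def gen_power_mult_single)
  have weight_w: "weight w = q ^ b"
  proof -
    have "weight w = q ^ b * \<alpha> ^ (j + b + (n - 1) * (j + b))"
      using c_neq_d by (simp add: weight_def w_def zs_def power_mult_distrib power_add)
    also have "j + b + (n - 1) * (j + b) = n * (j + b)"
      using n_gt by (simp add: mult_eq_if)
    finally show ?thesis by (simp add: power_mult \<alpha>_power)
  qed
  \<comment> \<open>The starting word has j + b letters \<open>d\<close> and the target has b, so
    degree forces l = j.\<close>
  have other: "Poly_Mapping.lookup ((X ^^ l) (gen d ^ j * r)) w = (if l = j then leading j else 0)" for l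
  proof (cases "l = j")
    case True
    then show ?thesis by (simp add: w_def lookup_X_funpow) (simp add: r_def)
  next
    case False
    have "w \<notin> Poly_Mapping.keys ((X ^^ l) (gen d ^ j * r))"
    proof
      assume "w \<in> Poly_Mapping.keys ((X ^^ l) (gen d ^ j * r))"
      from keys_X_funpow[OF this] have "b + l = j + b"
        using c_neq_d by (simp add: start count_w zs_def count_list_append count_list_replicate)
      then show False using False by simp
    qed
    then show ?thesis using False by (simp add: in_keys_iff)
  qed
  have "0 = Poly_Mapping.lookup (rep T (taft_normal n f) (gen d ^ j * r)) w"
    by (simp add: assms)
  also have "\<dots> = (\<Sum>l<n. \<Sum>i<n. f i l * ((q ^ b) ^ i * (if l = j then leading j else 0)))"
    by (simp add: rep_taft_normal lookup_sum lookup_G_funpow other weight_w)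
  also have "\<dots> = (\<Sum>l<n. if l = j then (\<Sum>i<n. f i j * ((q ^ b) ^ i * leading j)) else 0)"
    by (rule sum.cong) auto
  also have "\<dots> = (\<Sum>i<n. f i j * (q ^ b) ^ i) * leading j"
    using ij by (simp add: sum.delta sum_distrib_right mult.assoc)
  finally show "(\<Sum>i<n. f i j * (q ^ b) ^ i) = 0" using leading_nonzero[OF ij(2)] by simp
qed

lemma rep_faithful:
  assumes "\<And>m. rep T p m = 0"
  shows "p \<in> rel_ideal (taft_rels n q)"
proof -
  obtain f where f: "taft_class n q p = taft_class n q (taft_normal n f)"
    using taft_normal_form n_gt by (metis less_trans zero_less_one)
  have "rep T (taft_normal n f) m = 0" for m
    using assms f hrep_class by metis
  then have "f i j = 0" if "i < n" "j < n" for i j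
    using taft_normal_faithful that by blast
  then have "taft_normal n f = 0"
    unfolding taft_normal_def by (intro sum.neutral ballI) simp
  then show ?thesis using f by (simp add: presented_class_eq_zero_iff)
qed

lemma taft_x_nonzero: "taft_x n q \<noteq> taft_class n q 0"
proof
  assume "taft_x n q = taft_class n q 0"
  then have "rep T (gen Gen_x) (gen d) = 0"
    unfolding taft_x_def presented_class_eq_zero_iff by (rule rep_rels)
  then have "scale \<eta> (gen c) = 0" by (simp add: T_simps X_gen)
  then have "Poly_Mapping.lookup (scale \<eta> (gen c)) (Word [c]) = 0" by simp
  then show False using \<eta>_nonzero by (simp add: gen_def)
qed

end

section \<open>Inner faithfulness on the quotient\<close>

locale taft_plane = skew_derivation n q \<alpha> \<eta> c d
  for n and q \<alpha> \<eta> :: "'k::field_char_0" and c d +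
  fixes R :: "(plane_gen, 'k) free_alg set"
  assumes stable_G: "r \<in> R \<Longrightarrow> G r \<in> rel_ideal R" and stable_X: "r \<in> R \<Longrightarrow> X r \<in> rel_ideal R"
    and independent: "scale a (gen c) + scale b (gen d) \<in> rel_ideal R \<Longrightarrow> a = 0 \<and> b = 0"
begin

sublocale taft_plane_action n q T R
proof
  show "T a r \<in> rel_ideal R" if "r \<in> R" for a r
    using that by (cases a) (simp_all add: T_simps stable_G stable_X)
qed (use n_gt in simp)

text \<open>Together with \<open>independent\<close> this transfers vanishing on a generator from
  the quotient back to the free algebra.\<close>

lemma rep_gen_span: "\<exists>a b. rep T p (gen e) = scale a (gen c) + scale b (gen d)"
proof (induction p rule: poly_mapping_linear_induct)
  case zero
  show ?case by (rule exI[of _ 0], rule exI[of _ 0]) (simp add: rep_zero_left)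
next
  case (add p r)
  then obtain a b a' b' where "rep T p (gen e) = scale a (gen c) + scale b (gen d)"
    "rep T r (gen e) = scale a' (gen c) + scale b' (gen d)" by blast
  then have "rep T (p + r) (gen e) = scale (a + a') (gen c) + scale (b + b') (gen d)"
    by (simp add: rep_add_left scale_add_left)
  then show ?case by blast
next
  case (single w k)
  have "\<exists>a b. foldr T ws (gen e) = scale a (gen c) + scale b (gen d)" for ws
  proof (induction ws)
    case Nil
    have "gen c = scale 1 (gen c) + scale 0 (gen d)" "gen d = scale 0 (gen c) + scale 1 (gen d)"
      by simp_all
    then show ?case using gen_cases[of e] by (metis foldr_Nil id_apply)
  next
    case (Cons t ws)
    then obtain a b where "foldr T ws (gen e) = scale a (gen c) + scale b (gen d)" by blast
    then have "foldr T (t # ws) (gen e) = (case t of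
        Gen_g \<Rightarrow> scale (a * \<alpha>) (gen c) + scale (b * (q * \<alpha>)) (gen d)
      | Gen_x \<Rightarrow> scale (b * \<eta>) (gen c) + scale 0 (gen d))"
      by (cases t) (simp_all add: T_simps G_lin_simps X_lin_simps G_gen X_gen)
    then show ?case by (cases t) (simp_all only: taft_gen.case, blast+)
  qed
  then obtain a b where "foldr T (letters w) (gen e) = scale a (gen c) + scale b (gen d)" by blast
  then have "rep T (Poly_Mapping.single w k) (gen e) = scale (k * a) (gen c) + scale (k * b) (gen d)"
    by (simp add: rep_single scale_add_right)
  then show ?case by blast
qed

text \<open>Induction on the word, with the element of the ideal arbitrary because the hypothesis is
  applied to tensor factors of its coproduct. Annihilation of A enters only on single generators;
  the empty word is handled by the counit.\<close>

lemma hopf_ideal_annihilator: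
  assumes I: "hopf_ideal (taft_algebra n q) I"
    and kill: "\<And>h r. h \<in> I \<Longrightarrow> r \<in> carrier (presented_algebra R) \<Longrightarrow> act h r = \<zero>\<^bsub>presented_algebra R\<^esub>"
    and "taft_class n q p \<in> I"
  shows "rep T p (Poly_Mapping.single (Word ws) 1) = 0"
  using assms(3)
proof (induction ws arbitrary: p)
  case Nil
  have "rep T p 1 = scale (counit_free taft_eps p) 1"
    by (rule rep_counit_free[OF lin_T])
      (simp add: taft_eps_def g_one x_one split: taft_gen.split)
  moreover have "counit (taft_algebra n q) (taft_class n q p) = 0"
    using I Nil by (simp add: hopf_ideal_def)
  ultimately show ?case by (simp add: single_Word_Nil counit_taft_class n_pos)
next
  case (Cons a ws)
  obtain t where t: "t \<in> comult (taft_algebra n q) (taft_class n q p)"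
    and keys: "Poly_Mapping.keys t \<subseteq> I \<times> carrier (taft_algebra n q) \<union> carrier (taft_algebra n q) \<times> I"
    using I Cons.prems by (auto simp: hopf_ideal_def)
  have I_class: "\<exists>p. h = taft_class n q p" if "h \<in> I" for h
  proof -
    have "h \<in> carrier (taft_algebra n q)"
      using I that unfolding hopf_ideal_def
      by (meson additive_subgroup.a_Hcarr ideal.axioms(1))
    then show ?thesis by (auto simp: taft_algebra_simps carrier_presented)
  qed
  \<comment> \<open>The image of a generator lies in span(u, v), which meets the relation ideal only
    in 0, so vanishing in A is vanishing in the free algebra.\<close>
  have gen_zero: "hrep h (gen a) = 0" if "h \<in> I" for h
  proof -
    obtain p where p: "h = taft_class n q p" using I_class \<open>h \<in> I\<close> by blast
    have "act h (presented_class R (gen a)) = presented_class R 0"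
      using kill[OF \<open>h \<in> I\<close>] by (simp add: zero_presented)
    then have "rep T p (gen a) \<in> rel_ideal R"
      by (simp add: p act_class presented_class_eq_zero_iff)
    then show ?thesis using rep_gen_span[of p a] independent by (fastforce simp: p)
  qed
  have "hrep (fst k) (gen a) * hrep (snd k) (Poly_Mapping.single (Word ws) 1) = 0"
    if "k \<in> Poly_Mapping.keys t" for k
  proof -
    \<comment> \<open>Either the left factor kills the first letter or the right factor kills the
      rest of the word by induction.\<close>
    have "fst k \<in> I \<or> snd k \<in> I" using keys that by auto
    then show ?thesis
    proof
      assume "snd k \<in> I"
      then show ?thesis using I_class Cons.IH by fastforce
    qed (simp add: gen_zero)
  qed
  then show ?case
    unfolding single_word_Cons leibniz[OF t] by (simp add: linext_def)
qed

lemma inner_faithful_act: "inner_faithful (taft_algebra n q) (presented_algebra R) act"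
  unfolding inner_faithful_def
proof (intro allI impI)
  fix I
  assume *: "hopf_ideal (taft_algebra n q) I \<and>
    (\<forall>h\<in>I. \<forall>r\<in>carrier (presented_algebra R). act h r = \<zero>\<^bsub>presented_algebra R\<^esub>)"
  then have I: "ideal I (taft_algebra n q)" by (simp add: hopf_ideal_def)
  have "h = \<zero>\<^bsub>taft_algebra n q\<^esub>" if "h \<in> I" for h
  proof -
    have "h \<in> carrier (taft_algebra n q)"
      using I that by (meson additive_subgroup.a_Hcarr ideal.axioms(1))
    then obtain p where p: "h = taft_class n q p" by (auto simp: taft_algebra_simps carrier_presented)
    have "rep T p m = 0" for m
    proof (rule lin_eqI[OF lin_rep[OF lin_T] lin_const_zero])
      show "rep T p (Poly_Mapping.single w 1) = 0" for w
        using hopf_ideal_annihilator[of I p "letters w"] * that p by simp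
    qed
    then have "p \<in> rel_ideal (taft_rels n q)" by (rule rep_faithful)
    then show ?thesis by (simp add: p taft_algebra_simps zero_presented presented_class_eq_zero_iff)
  qed
  moreover have "\<zero>\<^bsub>taft_algebra n q\<^esub> \<in> I"
    using I by (meson additive_subgroup.zero_closed ideal.axioms(1))
  ultimately show "I = {\<zero>\<^bsub>taft_algebra n q\<^esub>}" by blast
qed

end



section \<open>A basis of the plane, and the Hopf ideal generated by x\<close>

text \<open>The parameter \<kappa> treats both algebras together: 0 gives the quantum plane, 1 the
  quantum Weyl algebra.\<close>

definition plane_rel :: "'k::field \<Rightarrow> 'k \<Rightarrow> (plane_gen, 'k) free_alg" where
  "plane_rel \<mu> \<kappa> = gen Gen_u * gen Gen_v - scale \<mu> (gen Gen_v * gen Gen_u) - const \<kappa>"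

text \<open>Left multiplication on the basis \<open>v\<^sup>i u\<^sup>j\<close>, indexed by \<open>(i, j)\<close>; at \<open>i = 0\<close> the truncated index \<open>i - 1\<close> carries
  the coefficient \<open>0\<close>.\<close>

definition pbw_op :: "'k::field \<Rightarrow> 'k \<Rightarrow> plane_gen \<Rightarrow> (nat \<times> nat \<Rightarrow>\<^sub>0 'k) \<Rightarrow> (nat \<times> nat \<Rightarrow>\<^sub>0 'k)" where
  "pbw_op \<mu> \<kappa> a = (case a of
      Gen_u \<Rightarrow> linext (\<lambda>(i, j). Poly_Mapping.single (i, Suc j) (\<mu> ^ i)
        + Poly_Mapping.single (i - 1, j) (\<kappa> * (\<Sum>l<i. \<mu> ^ l)))
    | Gen_v \<Rightarrow> linext (\<lambda>(i, j). Poly_Mapping.single (Suc i, j) 1))"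

lemma lin_pbw_op: "lin (pbw_op \<mu> \<kappa> a)"
  by (cases a) (simp_all add: pbw_op_def lin_linext)

lemma pbw_op_single:
  "pbw_op \<mu> \<kappa> Gen_v (Poly_Mapping.single (i, j) c) = Poly_Mapping.single (Suc i, j) c"
  "pbw_op \<mu> \<kappa> Gen_u (Poly_Mapping.single (i, j) c) = Poly_Mapping.single (i, Suc j) (c * \<mu> ^ i)
    + Poly_Mapping.single (i - 1, j) (c * \<kappa> * (\<Sum>l<i. \<mu> ^ l))"
  by (simp_all add: pbw_op_def scale_add_right mult.assoc)

text \<open>The operators encode u v^i = \<mu>^i v^i u + \<kappa> [i]_\<mu> v^(i-1). The relation
  then reduces to [i+1]_\<mu> = 1 + \<mu> [i]_\<mu>.\<close>

lemma rep_plane_rel: "rep (pbw_op \<mu> \<kappa>) (plane_rel \<mu> \<kappa>) m = 0"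
proof (rule lin_eqI[OF lin_rep[OF lin_pbw_op] lin_const_zero])
  fix k :: "nat \<times> nat"
  obtain i j where k: "k = (i, j)" by fastforce
  let ?e = "\<lambda>k c. Poly_Mapping.single k (c :: 'a)"
  have geo: "(\<Sum>l<Suc i. \<mu> ^ l) = 1 + \<mu> * (\<Sum>l<i. \<mu> ^ l)"
    unfolding sum.lessThan_Suc_shift by (simp add: sum_distrib_left)
  have uv: "rep (pbw_op \<mu> \<kappa>) (gen Gen_u * gen Gen_v) (?e (i, j) 1) =
      ?e (Suc i, Suc j) (\<mu> ^ Suc i) + ?e (i, j) (\<kappa> * (1 + \<mu> * (\<Sum>l<i. \<mu> ^ l)))"
    by (simp add: rep_mult[OF lin_pbw_op] pbw_op_single geo del: sum.lessThan_Suc)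
  have vu: "rep (pbw_op \<mu> \<kappa>) (gen Gen_v * gen Gen_u) (?e (i, j) 1) =
      ?e (Suc i, Suc j) (\<mu> ^ i) + ?e (i, j) (\<kappa> * (\<Sum>l<i. \<mu> ^ l))"
    \<comment> \<open>At i = 0 the truncated index would send the second term to v instead of 1, but
      its coefficient is an empty sum.\<close>
    by (cases i) (simp_all add: rep_mult[OF lin_pbw_op] pbw_op_single lin_add[OF lin_pbw_op])
  show "rep (pbw_op \<mu> \<kappa>) (plane_rel \<mu> \<kappa>) (?e k 1) = 0"
    unfolding plane_rel_def k rep_diff_left rep_scale_left uv vu
    by (simp add: scale_add_right distrib_left mult_ac flip: single_add)
      (simp add: single_add)
qed

text \<open>Letting \<open>p\<close> act on the basis vector of v^0 u^0 = 1 writes its image in A in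
  the basis.\<close>

definition pbw_coeff :: "'k::field \<Rightarrow> 'k \<Rightarrow> (plane_gen, 'k) free_alg \<Rightarrow> nat \<times> nat \<Rightarrow> 'k" where
  "pbw_coeff \<mu> \<kappa> p = Poly_Mapping.lookup (rep (pbw_op \<mu> \<kappa>) p (Poly_Mapping.single (0, 0) 1))"

lemma pbw_coeff_rel_ideal: "p \<in> rel_ideal {plane_rel \<mu> \<kappa>} \<Longrightarrow> pbw_coeff \<mu> \<kappa> p k = 0"
proof -
  assume p: "p \<in> rel_ideal {plane_rel \<mu> \<kappa>}"
  have "rep (pbw_op \<mu> \<kappa>) p (Poly_Mapping.single (0, 0) 1) = 0"
    by (rule rep_rel_ideal[OF lin_pbw_op _ p]) (simp add: rep_plane_rel)
  then show ?thesis by (simp add: pbw_coeff_def)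
qed

lemma pbw_coeff_simps:
  "pbw_coeff \<mu> \<kappa> (p + r) k = pbw_coeff \<mu> \<kappa> p k + pbw_coeff \<mu> \<kappa> r k"
  "pbw_coeff \<mu> \<kappa> (p - r) k = pbw_coeff \<mu> \<kappa> p k - pbw_coeff \<mu> \<kappa> r k"
  "pbw_coeff \<mu> \<kappa> (scale c p) k = c * pbw_coeff \<mu> \<kappa> p k"
  "pbw_coeff \<mu> \<kappa> (- p) k = - pbw_coeff \<mu> \<kappa> p k"
  by (simp_all add: pbw_coeff_def rep_add_left rep_diff_left rep_scale_left lookup_add lookup_minus
      lin_minus[OF lin_rep_left])

lemma pbw_coeff_monomials:
  "pbw_coeff \<mu> \<kappa> (gen Gen_u) k = (if k = (0, 1) then 1 else 0)"
  "pbw_coeff \<mu> \<kappa> (gen Gen_v) k = (if k = (1, 0) then 1 else 0)"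
  "pbw_coeff \<mu> \<kappa> 1 k = (if k = (0, 0) then 1 else 0)"
  "pbw_coeff \<mu> \<kappa> (gen Gen_u * gen Gen_u) k = (if k = (0, 2) then 1 else 0)"
  "pbw_coeff \<mu> \<kappa> (gen Gen_v * gen Gen_v) k = (if k = (2, 0) then 1 else 0)"
  "pbw_coeff \<mu> \<kappa> (gen Gen_v * gen Gen_u) k = (if k = (1, 1) then 1 else 0)"
  "pbw_coeff \<mu> \<kappa> (gen Gen_u * gen Gen_v) k = (if k = (1, 1) then \<mu> else if k = (0, 0) then \<kappa> else 0)"
  by (auto simp add: pbw_coeff_def rep_mult[OF lin_pbw_op] pbw_op_single lookup_single when_def
      lookup_add numeral_2_eq_2)

lemma plane_gens_independent:
  assumes "scale a (gen Gen_u) + scale b (gen Gen_v) \<in> rel_ideal {plane_rel \<mu> \<kappa>}"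
  shows "a = 0 \<and> b = 0"
  using pbw_coeff_rel_ideal[OF assms, of "(0, 1)"] pbw_coeff_rel_ideal[OF assms, of "(1, 0)"]
  by (simp add: pbw_coeff_simps pbw_coeff_monomials)

text \<open>Right multiplication turns the antihomomorphism into a representation.\<close>

lemma rep_antipode: "rep (\<lambda>a m. m * s a) p m = m * antipode_free s p"
  for m :: "('x, 'k::field) free_alg"
proof -
  have "foldr (\<lambda>a m. m * s a) ws m = m * prod_list (map s (rev ws))" for ws
    by (induction ws) (simp_all add: mult.assoc)
  then show ?thesis by (simp add: rep_def linext_def antipode_free_def sum_distrib_left)
qed

lemma lin_mult_by: "lin (\<lambda>m. m * (r :: ('x, 'k::field) free_alg))"
  by (rule lin_mult_right[OF lin_id])

lemma antipode_free_eq_rep: "antipode_free s p = rep (\<lambda>a m. m * s a) p 1"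
  by (simp add: rep_antipode)

lemma lin_antipode_free: "lin (antipode_free s)"
  unfolding antipode_free_eq_rep [abs_def] by (rule lin_rep_left)

lemma antipode_free_mult: "antipode_free s (p * r) = antipode_free s r * antipode_free s p"
  using rep_mult[of "\<lambda>a m. m * s a" p r 1, OF lin_mult_by] by (simp add: rep_antipode)

lemma antipode_free_gen: "antipode_free s (gen a) = s a"
  by (simp add: antipode_free_eq_rep)

lemma antipode_free_one: "antipode_free s 1 = 1"
  by (simp add: antipode_free_eq_rep)

lemma antipode_free_power: "antipode_free s (p ^ k) = antipode_free s p ^ k"
  by (induction k) (simp_all add: antipode_free_one antipode_free_mult power_commutes)

text \<open>Well-definedness of the antipode, checked on the three relations; reversing products
  does no harm to a two-sided ideal.\<close>

lemma antipode_taft_rel_ideal: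
  assumes n: "n > 0" and q: "q ^ n = 1" and "p \<in> rel_ideal (taft_rels n q)"
  shows "antipode_free (taft_anti n) p \<in> rel_ideal (taft_rels n q)"
  using assms(3)
proof (induction p rule: rel_ideal_induct)
  case (base r)
  let ?g = "gen Gen_g :: (taft_gen, 'a) free_alg" and ?x = "gen Gen_x :: (taft_gen, 'a) free_alg"
  let ?N = "n - 1"
  have q_Suc: "q * q ^ ?N = q ^ n" using n by (simp flip: power_Suc)
  consider "r = ?g ^ n - 1" | "r = ?x ^ n" | "r = ?x * ?g - scale q (?g * ?x)"
    using base by (auto simp: taft_rels_def const_mult)
  then show ?case
  proof cases
    case 1
    have "(?g ^ ?N) ^ n = (?g ^ n) ^ ?N" by (metis mult.commute power_mult)
    then have "taft_class n q ((?g ^ ?N) ^ n) = taft_class n q ((?g ^ n) ^ ?N)" by (rule arg_cong)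
    also have "\<dots> = taft_class n q (1 ^ ?N)"
      by (rule presented_class_power_cong[OF taft_g_power])
    finally show ?thesis
      by (simp add: 1 lin_diff[OF lin_antipode_free] antipode_free_one antipode_free_power
          antipode_free_gen taft_anti_def presented_class_eq_iff)
  next
    case 2
    \<comment> \<open>S(x) has degree 1 in x, so its n-th power has degree n and vanishes; the
      scalar it acquires is never computed.\<close>
    have "taft_monomial n q 1 (scale (- 1) (?g ^ ?N * ?x))"
      using taft_monomial_mult[OF taft_monomial_gen(2,3)] by (intro taft_monomial_scale) fastforce
    from taft_monomial_high[OF taft_monomial_power[OF this]] show ?thesis
      by (simp add: 2 antipode_free_power antipode_free_gen taft_anti_def scale_minus_left)
  next
    case 3
    \<comment> \<open>Moving x past g^(n-1) costs q^(n-1), which completes the factor q of the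
      relation to q^n = 1.\<close>
    have "taft_class n q (?g ^ ?N * (?x * ?g ^ ?N)) =
        taft_class n q (?g ^ ?N * scale (q ^ ?N) (?g ^ ?N * ?x))"
      by (intro presented_class_mult_cong taft_x_g_power refl)
    from presented_class_scale_cong[OF this, of q]
    have "taft_class n q (scale q (?g ^ ?N * ?x * ?g ^ ?N)) =
        taft_class n q (scale (q ^ n) (?g ^ ?N * (?g ^ ?N * ?x)))"
      by (simp add: mult.assoc q_Suc [simplified])
    then show ?thesis
      by (simp add: 3 q lin_diff[OF lin_antipode_free] lin_scale[OF lin_antipode_free] antipode_free_mult
          antipode_free_gen taft_anti_def presented_class_eq_iff scale_minus_right)
  qed
qed (simp_all add: lin_zero[OF lin_antipode_free] lin_add[OF lin_antipode_free] antipode_free_mult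
    rel_ideal_add rel_ideal_mult_left rel_ideal_mult_right)

lemma antipode_taft_class:
  assumes "n > 0" "q ^ n = 1"
  shows "antipode (taft_algebra n q) (taft_class n q p) = taft_class n q (antipode_free (taft_anti n) p)"
proof -
  have "taft_class n q (antipode_free (taft_anti n) r) = taft_class n q (antipode_free (taft_anti n) p)"
    if "r \<in> taft_class n q p" for r
    using antipode_taft_rel_ideal[OF assms, of "r - p"] that
    by (simp add: mem_presented_class presented_class_eq_iff lin_diff[OF lin_antipode_free])
  then have "(\<Union>r\<in>taft_class n q p. taft_class n q (antipode_free (taft_anti n) r)) =
      (\<Union>r\<in>taft_class n q p. taft_class n q (antipode_free (taft_anti n) p))"
    by (intro SUP_cong refl)
  moreover have "taft_class n q p \<noteq> {}" using presented_class_self by blast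
  ultimately show ?thesis by (simp add: taft_algebra_simps(9))
qed

section \<open>The Hopf ideal generated by x\<close>

lemma ring_taft_algebra: "ring (taft_algebra n q)"
proof -
  interpret ring "taft_base n q" by (rule ring_presented_algebra)
  show ?thesis
  proof (rule ringI)
    show "abelian_group (taft_algebra n q)"
    proof (rule abelian_groupI)
      fix h assume "h \<in> carrier (taft_algebra n q)"
      then have "\<ominus>\<^bsub>taft_base n q\<^esub> h \<in> carrier (taft_algebra n q)"
        "\<ominus>\<^bsub>taft_base n q\<^esub> h \<oplus>\<^bsub>taft_algebra n q\<^esub> h = \<zero>\<^bsub>taft_algebra n q\<^esub>"
        by (simp_all add: taft_algebra_simps(1-6) l_neg)
      then show "\<exists>k\<in>carrier (taft_algebra n q). k \<oplus>\<^bsub>taft_algebra n q\<^esub> h = \<zero>\<^bsub>taft_algebra n q\<^esub>"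
        by blast
    qed (simp_all add: taft_algebra_simps(1-6) a_ac)
    show "Group.monoid (taft_algebra n q)"
      by (rule monoidI) (simp_all add: taft_algebra_simps(1-6) m_assoc)
  qed (simp_all add: taft_algebra_simps(1-6) l_distr r_distr)
qed

text \<open>The two-sided ideal of the free algebra generated by x, described through its words so
  that closure properties become statements about supports.\<close>

definition x_part :: "(taft_gen, 'k::field) free_alg set" where
  "x_part = {p. \<forall>w\<in>Poly_Mapping.keys p. Gen_x \<in> set (letters w)}"

lemma x_part_zero: "0 \<in> x_part"
  by (simp add: x_part_def)

lemma x_part_add: "p \<in> x_part \<Longrightarrow> r \<in> x_part \<Longrightarrow> p + r \<in> x_part"
  unfolding x_part_def using keys_add[of p r] by blast

lemma x_part_scale: "p \<in> x_part \<Longrightarrow> scale c p \<in> x_part"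
  unfolding x_part_def using keys_scale[of c p] by blast

lemma x_part_mult_left: "p \<in> x_part \<Longrightarrow> r * p \<in> x_part"
  unfolding x_part_def using keys_mult[of r p] by (force simp: plus_fword_def)

lemma x_part_mult_right: "p \<in> x_part \<Longrightarrow> p * r \<in> x_part"
  unfolding x_part_def using keys_mult[of p r] by (force simp: plus_fword_def)

lemma x_part_induct [consumes 1, case_names zero add word]:
  assumes "p \<in> x_part" "P 0" "\<And>p r. P p \<Longrightarrow> P r \<Longrightarrow> P (p + r)"
    and "\<And>ws vs c. P (Poly_Mapping.single (Word (ws @ Gen_x # vs)) c)"
  shows "P p"
proof -
  have *: "P (\<Sum>w\<in>K. Poly_Mapping.single w (f w))" if "finite K" "\<forall>w\<in>K. Gen_x \<in> set (letters w)" for K f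
    using that
  proof (induction K rule: finite_induct)
    case (insert w K)
    then obtain ws vs where "letters w = ws @ Gen_x # vs" by (auto dest: split_list)
    then have "w = Word (ws @ Gen_x # vs)" by (metis fword.collapse)
    then have "P (Poly_Mapping.single w (f w))" using assms(4) by simp
    then show ?case using insert assms(3) by simp
  qed (simp add: assms(2))
  show ?thesis
    using *[of "Poly_Mapping.keys p" "Poly_Mapping.lookup p"] assms(1)
    by (simp add: x_part_def flip: poly_mapping_expansion)
qed

lemma single_word_append:
  "Poly_Mapping.single (Word (ws @ vs)) c =
    Poly_Mapping.single (Word ws) c * Poly_Mapping.single (Word vs) (1 :: 'k::field)"
  by (simp add: mult_single plus_fword_def)

lemma gen_x_x_part: "gen Gen_x \<in> x_part"
  by (simp add: x_part_def gen_def)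

lemma antipode_x_part: "p \<in> x_part \<Longrightarrow> antipode_free (taft_anti n) p \<in> x_part"
proof (induction p rule: x_part_induct)
  case (word ws vs c)
  have "antipode_free (taft_anti n) (gen Gen_x) \<in> x_part"
    using x_part_scale[OF x_part_mult_left[OF gen_x_x_part], of "-1" "gen Gen_g ^ (n - 1)"]
    by (simp add: antipode_free_gen taft_anti_def scale_minus_left)
  then show ?case
    unfolding single_word_append single_word_Cons antipode_free_mult
    by (intro x_part_mult_right x_part_mult_left)
qed (simp_all add: x_part_zero x_part_add lin_zero[OF lin_antipode_free] lin_add[OF lin_antipode_free])

definition x_ideal :: "nat \<Rightarrow> 'k::field \<Rightarrow> (taft_gen, 'k) free_alg set set" where
  "x_ideal n q = taft_class n q ` x_part"

lemma taft_x_in_x_ideal: "taft_x n q \<in> x_ideal n q"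
  by (simp add: x_ideal_def taft_x_def gen_x_x_part)

lemma x_ideal_mult:
  assumes "h \<in> carrier (taft_base n q)" "k \<in> x_ideal n q"
  shows "h \<otimes>\<^bsub>taft_base n q\<^esub> k \<in> x_ideal n q" "k \<otimes>\<^bsub>taft_base n q\<^esub> h \<in> x_ideal n q"
  using assms by (auto simp: x_ideal_def carrier_presented intro: x_part_mult_left x_part_mult_right)

lemma ideal_x_ideal: "ideal (x_ideal n q) (taft_algebra n q)"
proof (rule idealI[OF ring_taft_algebra])
  interpret ring "taft_algebra n q" by (rule ring_taft_algebra)
  show "subgroup (x_ideal n q) (add_monoid (taft_algebra n q))"
  proof (rule add.subgroupI)
    show "x_ideal n q \<subseteq> carrier (taft_algebra n q)"
      by (auto simp: x_ideal_def taft_algebra_simps(1))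
    show "x_ideal n q \<noteq> {}" using taft_x_in_x_ideal by blast
  next
    fix h assume "h \<in> x_ideal n q"
    then obtain p where p: "h = taft_class n q p" "p \<in> x_part" by (auto simp: x_ideal_def)
    have "\<ominus>\<^bsub>taft_algebra n q\<^esub> h = taft_class n q (- p)"
      by (rule minus_equality) (simp_all add: p(1) taft_algebra_simps(1-6) zero_presented)
    moreover have "- p \<in> x_part" using x_part_scale[OF p(2), of "-1"] by (simp add: scale_minus_left)
    ultimately show "\<ominus>\<^bsub>taft_algebra n q\<^esub> h \<in> x_ideal n q"
      by (simp add: x_ideal_def)
  next
    fix h k assume "h \<in> x_ideal n q" "k \<in> x_ideal n q"
    then show "h \<oplus>\<^bsub>taft_algebra n q\<^esub> k \<in> x_ideal n q"
      by (auto simp: x_ideal_def taft_algebra_simps(1-6) x_part_add)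
  qed
qed (simp_all add: taft_algebra_simps(1-6) x_ideal_mult)

text \<open>Both terms of the coproduct of x contain x in one slot, and multiplying by the remaining
  letters stays in the ideal in that slot.\<close>

lemma keys_taft_delta_word_x:
  "Gen_x \<in> set ws \<Longrightarrow> Poly_Mapping.keys (taft_delta_word n q ws) \<subseteq>
    x_ideal n q \<times> carrier (taft_base n q) \<union> carrier (taft_base n q) \<times> x_ideal n q"
proof (induction ws)
  case (Cons a ws)
  interpret H: ring "taft_base n q" by (rule ring_presented_algebra)
  show ?case
  proof
    fix k assume "k \<in> Poly_Mapping.keys (taft_delta_word n q (a # ws))"
    then obtain i j where i: "i \<in> Poly_Mapping.keys (taft_delta n q a)"
      and j: "j \<in> Poly_Mapping.keys (taft_delta_word n q ws)"
      and k: "k = (fst i \<otimes>\<^bsub>taft_base n q\<^esub> fst j, snd i \<otimes>\<^bsub>taft_base n q\<^esub> snd j)"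
      using keys_tensor_mult by fastforce
    have ic: "fst i \<in> carrier (taft_base n q)" "snd i \<in> carrier (taft_base n q)"
      using keys_taft_delta[of n q a] i by auto
    have jc: "fst j \<in> carrier (taft_base n q)" "snd j \<in> carrier (taft_base n q)"
      using keys_taft_delta_word[of n q ws] j by auto
    have "(fst i \<in> x_ideal n q \<or> snd i \<in> x_ideal n q) \<or> (fst j \<in> x_ideal n q \<or> snd j \<in> x_ideal n q)"
    proof (cases "a = Gen_x")
      case True
      then have "i = (taft_g n q, taft_x n q) \<or> i = (taft_x n q, taft_one n q)"
        using i subsetD[OF keys_add] by (fastforce simp: taft_delta_gen)
      then show ?thesis using taft_x_in_x_ideal[of n q] by auto
    next
      case False
      then show ?thesis using Cons j by auto
    qed
    then show "k \<in> x_ideal n q \<times> carrier (taft_base n q) \<union> carrier (taft_base n q) \<times> x_ideal n q"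
      using ic jc by (auto simp: k x_ideal_mult)
  qed
qed simp

lemma hopf_ideal_x_ideal:
  assumes "n > 0" "q ^ n = 1"
  shows "hopf_ideal (taft_algebra n q) (x_ideal n q)"
  unfolding hopf_ideal_def
proof (intro conjI allI ballI ideal_x_ideal)
  fix h assume "h \<in> x_ideal n q"
  then obtain p where h: "h = taft_class n q p" and p: "p \<in> x_part" by (auto simp: x_ideal_def)
  show "c \<odot>\<^bsub>taft_algebra n q\<^esub> h \<in> x_ideal n q" for c
    using p by (auto simp: h taft_algebra_simps(6) x_ideal_def intro: x_part_scale)
  show "antipode (taft_algebra n q) h \<in> x_ideal n q"
    using antipode_x_part[OF p] by (simp add: h antipode_taft_class[OF assms] x_ideal_def)
  have "prod_list (map (taft_eps :: _ \<Rightarrow> 'a) ws) = 0" if "Gen_x \<in> set ws" for ws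
    using that by (induction ws) (auto simp: taft_eps_def)
  then show "counit (taft_algebra n q) h = 0"
    using p by (simp add: h counit_taft_class[OF assms(1)] counit_free_def x_part_def)
  \<comment> \<open>\<open>hopf_ideal\<close> asks for one suitable expansion; the one computed word
    by word from \<open>p\<close> serves.\<close>
  let ?t = "comult_free (taft_base n q) (taft_delta n q) p"
  have "?t \<in> comult (taft_algebra n q) h"
    by (auto simp: h taft_algebra_simps(7) tensor_class_def tensor_null.zero intro!: bexI[of _ p])
  moreover have "Poly_Mapping.keys ?t \<subseteq>
      x_ideal n q \<times> carrier (taft_base n q) \<union> carrier (taft_base n q) \<times> x_ideal n q"
    unfolding comult_free_linext
    using keys_linext[of "\<lambda>w. taft_delta_word n q (letters w)" p] keys_taft_delta_word_x p
    by (fastforce simp: x_part_def)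
  ultimately show "\<exists>t\<in>comult (taft_algebra n q) h. Poly_Mapping.keys t \<subseteq>
      x_ideal n q \<times> carrier (taft_algebra n q) \<union> carrier (taft_algebra n q) \<times> x_ideal n q"
    unfolding taft_algebra_simps(1) by blast
qed



section \<open>Classification of linear actions\<close>

locale taft_action = hopf_action "taft_algebra n q" "presented_algebra R" act
  for n :: nat and q :: "'k::field_char_0" and R :: "(plane_gen, 'k) free_alg set" and act +
  assumes n_gt: "n > 1" and q_order: "has_mult_order q n"
begin

abbreviation pc where "pc \<equiv> presented_class R"

abbreviation act_g where "act_g \<equiv> act (taft_g n q)"
abbreviation act_x where "act_x \<equiv> act (taft_x n q)"

lemma taft_closed [simp]: "taft_class n q p \<in> carrier (taft_algebra n q)"
  "taft_g n q \<in> carrier (taft_algebra n q)" "taft_x n q \<in> carrier (taft_algebra n q)"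
  "taft_one n q \<in> carrier (taft_algebra n q)"
  by (simp_all add: taft_algebra_simps(1) taft_g_def taft_x_def taft_one_def)

lemma act_pc: "h \<in> carrier (taft_algebra n q) \<Longrightarrow> \<exists>s. act h (pc r) = pc s"
  using act_closed[of h "pc r"] by (auto simp: carrier_presented)

lemma act_pc_add: "h \<in> carrier (taft_algebra n q) \<Longrightarrow> act h (pc p) = pc p' \<Longrightarrow> act h (pc r) = pc r' \<Longrightarrow>
    act h (pc (p + r)) = pc (p' + r')"
  using act_add_right[of h "pc p" "pc r"] by simp

lemma act_pc_scale: "h \<in> carrier (taft_algebra n q) \<Longrightarrow> act h (pc p) = pc p' \<Longrightarrow>
    act h (pc (scale c p)) = pc (scale c p')"
  using act_smult_right[of h "pc p" c] by simp

lemma act_pc_zero: "h \<in> carrier (taft_algebra n q) \<Longrightarrow> act h (pc 0) = pc 0"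
  using act_pc_scale[of h 0 _ 0] act_pc[of h 0] by auto

lemma act_class_mult: "act (taft_class n q (p * r)) (pc s) = act (taft_class n q p) (act (taft_class n q r) (pc s))"
  using act_mult[of "taft_class n q p" "taft_class n q r" "pc s"] by (simp add: taft_algebra_simps(2))

lemma act_class_one: "act (taft_class n q 1) (pc s) = pc s"
  using act_one[of "pc s"] by (simp add: taft_algebra_simps(3) one_presented)

lemma comult_gen: "taft_delta n q a \<in> comult (taft_algebra n q) (taft_class n q (gen a))"
proof -
  have "taft_delta_word n q [a] = taft_delta n q a"
    by (cases a) (simp_all add: taft_delta_gen tensor_mult_linext one_presented taft_g_def taft_x_def
        taft_one_def lin_add[OF lin_linext])
  then have "comult_free (taft_base n q) (taft_delta n q) (gen a) = taft_delta n q a"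
    by (simp add: comult_free_linext gen_def)
  then show ?thesis
    unfolding taft_algebra_simps(7) tensor_class_def
    by (intro UN_I[of "gen a"]) (simp_all add: tensor_null.zero)
qed

lemma act_pc_mult:
  assumes "t \<in> comult (taft_algebra n q) h" "h \<in> carrier (taft_algebra n q)"
    and "\<And>k. k \<in> Poly_Mapping.keys t \<Longrightarrow>
      act (fst k) (pc r) \<otimes>\<^bsub>presented_algebra R\<^esub> act (snd k) (pc s) = pc (f k)"
  shows "act h (pc (r * s)) = pc (linext f t)"
proof -
  interpret A: ring "presented_algebra R" by (rule ring_presented_algebra)
  have "act h (pc (r * s)) = (\<Oplus>\<^bsub>presented_algebra R\<^esub>k\<in>Poly_Mapping.keys t.
      Poly_Mapping.lookup t k \<odot>\<^bsub>presented_algebra R\<^esub>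
        (act (fst k) (pc r) \<otimes>\<^bsub>presented_algebra R\<^esub> act (snd k) (pc s)))"
    using act_on_mult[OF assms(2) _ _ assms(1), of "pc r" "pc s"] by simp
  also have "\<dots> = (\<Oplus>\<^bsub>presented_algebra R\<^esub>k\<in>Poly_Mapping.keys t. pc (scale (Poly_Mapping.lookup t k) (f k)))"
    by (rule A.finsum_cong') (simp_all add: assms(3))
  finally show ?thesis by (simp add: finsum_presented linext_def)
qed

lemma act_g_mult:
  assumes "act_g (pc r) = pc r'" "act_g (pc s) = pc s'"
  shows "act_g (pc (r * s)) = pc (r' * s')"
proof -
  have "act_g (pc (r * s)) = pc (linext (\<lambda>k. r' * s') (taft_delta n q Gen_g))"
    using comult_gen[of Gen_g]
    by (intro act_pc_mult) (simp_all add: assms taft_delta_gen flip: taft_g_def)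
  then show ?thesis by (simp add: taft_delta_gen)
qed

lemma act_x_mult:
  assumes "act_g (pc r) = pc r'" "act_x (pc s) = pc s''" "act_x (pc r) = pc r''"
  shows "act_x (pc (r * s)) = pc (r' * s'' + r'' * s)"
proof -
  \<comment> \<open>Choosing representatives as a function of the pair is consistent whether or not
    the two pairs in the coproduct of x coincide; linearity of \<open>linext\<close> then separates
    the terms.\<close>
  define f where "f k = (SOME p. act (fst k) (pc r) \<otimes>\<^bsub>presented_algebra R\<^esub> act (snd k) (pc s) = pc p)" for k
  have f: "pc (f (h, h')) = act h (pc r) \<otimes>\<^bsub>presented_algebra R\<^esub> act h' (pc s)"
    if "h \<in> carrier (taft_algebra n q)" "h' \<in> carrier (taft_algebra n q)" for h h'
  proof -
    have "\<exists>p. act h (pc r) \<otimes>\<^bsub>presented_algebra R\<^esub> act h' (pc s) = pc p"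
      using act_pc[of h r] act_pc[of h' s] that by auto
    from someI_ex[OF this] show ?thesis by (simp add: f_def)
  qed
  have "act_x (pc (r * s)) = pc (linext f (taft_delta n q Gen_x))"
  proof (rule act_pc_mult)
    show "taft_delta n q Gen_x \<in> comult (taft_algebra n q) (taft_x n q)"
      using comult_gen[of Gen_x] by (simp add: taft_x_def)
    fix k assume "k \<in> Poly_Mapping.keys (taft_delta n q Gen_x)"
    then have "fst k \<in> carrier (taft_algebra n q)" "snd k \<in> carrier (taft_algebra n q)"
      using keys_taft_delta[of n q Gen_x] by (auto simp: taft_algebra_simps(1))
    then show "act (fst k) (pc r) \<otimes>\<^bsub>presented_algebra R\<^esub> act (snd k) (pc s) = pc (f k)"
      using f[of "fst k" "snd k"] by simp
  qed simp
  also have "\<dots> = pc (f (taft_g n q, taft_x n q)) \<oplus>\<^bsub>presented_algebra R\<^esub> pc (f (taft_x n q, taft_one n q))"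
    by (simp add: taft_delta_gen lin_add[OF lin_linext])
  also have "\<dots> = pc (r' * s'' + r'' * s)"
    using act_class_one[of s] by (simp only: f taft_closed) (simp add: assms taft_one_def)
  finally show ?thesis .
qed

lemma act_g_one: "act_g (pc 1) = pc 1"
  and act_x_one: "act_x (pc 1) = pc 0"
proof -
  have "counit_free taft_eps (gen Gen_g) = (1 :: 'k)" "counit_free taft_eps (gen Gen_x) = (0 :: 'k)"
    by (simp_all add: counit_free_def gen_def taft_eps_def)
  then show "act_g (pc 1) = pc 1" "act_x (pc 1) = pc 0"
    using act_on_one[of "taft_g n q"] act_on_one[of "taft_x n q"] n_gt
    by (simp_all add: one_presented taft_g_def taft_x_def counit_taft_class)
qed

lemma act_x_g: "act_x (act_g (pc r)) = q \<odot>\<^bsub>presented_algebra R\<^esub> act_g (act_x (pc r))"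
proof -
  have "act_x (act_g (pc r)) = act (taft_class n q (scale q (gen Gen_g * gen Gen_x))) (pc r)"
    by (simp add: taft_g_def taft_x_def taft_x_g flip: act_class_mult)
  also have "\<dots> = q \<odot>\<^bsub>presented_algebra R\<^esub> act (taft_class n q (gen Gen_g * gen Gen_x)) (pc r)"
    using act_smult_left[of "taft_class n q (gen Gen_g * gen Gen_x)" "pc r" q]
    by (simp add: taft_algebra_simps(6))
  finally show ?thesis by (simp add: taft_g_def taft_x_def act_class_mult)
qed

lemma act_class_power: "act (taft_class n q (p ^ k)) (pc r) = (act (taft_class n q p) ^^ k) (pc r)"
proof (induction k)
  case (Suc k)
  then show ?case by (simp add: act_class_mult)
qed (simp add: act_class_one)

lemma act_g_power: "(act_g ^^ n) (pc r) = pc r"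
  using act_class_power[of "gen Gen_g" n r] by (simp add: taft_g_def taft_g_power act_class_one)

lemma act_x_power: "(act_x ^^ n) (pc r) = pc 0"
proof -
  have "act (taft_class n q 0) (pc r) = pc 0"
    using act_smult_left[of "taft_class n q 0" "pc r" 0] act_pc[of "taft_class n q 0" r]
    by (auto simp: taft_algebra_simps(6))
  then show ?thesis
    using act_class_power[of "gen Gen_x" n r] by (simp add: taft_x_def taft_x_power)
qed

text \<open>The skew product rule makes x act by zero on all of A once it kills u and v. A word
  containing x acts as a composition through x, hence by zero.\<close>

lemma act_x_ideal:
  assumes "act_x (pc (gen Gen_u)) = pc 0" "act_x (pc (gen Gen_v)) = pc 0" "h \<in> x_ideal n q"
  shows "act h (pc r) = pc 0"
proof -
  have x_zero: "act_x (pc r) = pc 0" for r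
  proof (induction r rule: free_alg_induct)
    case (gen_mult a r)
    obtain s where "act_g (pc (gen a)) = pc s" using act_pc[of "taft_g n q"] by auto
    moreover have "act_x (pc (gen a)) = pc 0" using assms(1,2) by (cases a) simp_all
    ultimately show ?case using act_x_mult[of "gen a" s r 0 0] gen_mult by simp
  next
    case (add p r)
    then show ?case using act_pc_add[of "taft_x n q" p 0 r 0] by simp
  next
    case (scale c p)
    then show ?case using act_pc_scale[of "taft_x n q" p 0 c] by simp
  qed (simp add: act_x_one)
  obtain p where p: "p \<in> x_part" "h = taft_class n q p" using assms(3) by (auto simp: x_ideal_def)
  from p(1) have "act (taft_class n q p) (pc r) = pc 0"
  proof (induction p rule: x_part_induct)
    case zero
    show ?case using act_smult_left[of "taft_class n q 0" "pc r" 0] act_pc[of "taft_class n q 0" r]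
      by (auto simp: taft_algebra_simps(6))
  next
    case (add p p')
    then show ?case
      using act_add_left[of "taft_class n q p" "taft_class n q p'" "pc r"]
      by (simp add: taft_algebra_simps(5))
  next
    case (word ws vs c)
    let ?w = "Poly_Mapping.single (Word ws) c" and ?v = "Poly_Mapping.single (Word vs) (1 :: 'k)"
    obtain s where "act (taft_class n q ?v) (pc r) = pc s" using act_pc by fastforce
    then have "act (taft_class n q (?w * (gen Gen_x * ?v))) (pc r) = act (taft_class n q ?w) (act_x (pc s))"
      by (simp add: act_class_mult act_pc taft_x_def)
    then show ?case unfolding single_word_append single_word_Cons by (simp add: x_zero act_pc_zero)
  qed
  then show ?thesis by (simp add: p(2))
qed

end

lemma act_x_nonzero:
  assumes "taft_action n q R act" "inner_faithful (taft_algebra n q) (presented_algebra R) act"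
    and "act (taft_x n q) (presented_class R (gen Gen_u)) = presented_class R 0"
  shows "act (taft_x n q) (presented_class R (gen Gen_v)) \<noteq> presented_class R 0"
proof
  interpret taft_action n q R act by fact
  \<comment> \<open>Any instance of the free construction shows that x is nonzero in the Taft
    algebra; \<alpha> = \<eta> = 1 is the simplest.\<close>
  interpret skew_derivation n q 1 1 Gen_u Gen_v
    by standard (use n_gt q_order in simp_all)
  assume v: "act (taft_x n q) (presented_class R (gen Gen_v)) = presented_class R 0"
  have "q ^ n = 1" using q_order by (simp add: has_mult_order_def)
  then have "hopf_ideal (taft_algebra n q) (x_ideal n q)"
    using n_gt by (intro hopf_ideal_x_ideal) simp_all
  moreover have "\<forall>h\<in>x_ideal n q. \<forall>r\<in>carrier (presented_algebra R). act h r = \<zero>\<^bsub>presented_algebra R\<^esub>"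
    using act_x_ideal[OF assms(3) v] by (auto simp: carrier_presented zero_presented)
  ultimately have "x_ideal n q = {\<zero>\<^bsub>taft_algebra n q\<^esub>}"
    using assms(2) by (simp add: inner_faithful_def)
  then have "taft_x n q = taft_class n q 0"
    using taft_x_in_x_ideal[of n q] by (simp add: taft_algebra_simps(4) zero_presented)
  then show False using taft_x_nonzero by simp
qed

text \<open>The rows of the matrices of \<open>g\<close> and \<open>x\<close> on \<open>span(u, v)\<close> are \<open>(a, b)\<close>, \<open>(c, d)\<close> and \<open>(p, r)\<close>, \<open>(s, t)\<close>. \<open>GR\<close> and \<open>XR\<close> are the
  coefficients of \<open>u\<^sup>2\<close>, \<open>v\<^sup>2\<close>, \<open>vu\<close> in the images of the defining relation, and \<open>G2\<close>, \<open>X2\<close> express \<open>g\<^sup>n = 1\<close>, \<open>x\<^sup>n = 0\<close>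
  when \<open>n = 2\<close>. The antidiagonal case, where \<open>\<mu> = -1\<close>, is excluded by \<open>4 p = 0\<close>.\<close>

lemma matrix_cases:
  fixes a b c d p r s t q \<mu> :: "'k::field_char_0"
  assumes q: "q \<noteq> 1" and mu: "\<mu> \<noteq> 1" "\<mu> \<noteq> 0"
    and G: "a \<noteq> 0 \<or> b \<noteq> 0" "c \<noteq> 0 \<or> d \<noteq> 0"
    and X: "p \<noteq> 0 \<or> r \<noteq> 0 \<or> s \<noteq> 0 \<or> t \<noteq> 0"
    and G2: "q ^ 2 = 1 \<Longrightarrow> a * a + b * c = 1" and X2: "q ^ 2 = 1 \<Longrightarrow> p * p + r * s = 0"
    and GR: "a * c - \<mu> * (c * a) = 0" "b * d - \<mu> * (d * b) = 0"
      "(a * d * \<mu> + b * c) - \<mu> * (c * b * \<mu> + d * a) = 0"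
    and XR: "a * s - \<mu> * (c * p + s) = 0" "b * t + r - \<mu> * (d * r) = 0"
      "(a * t * \<mu> + b * s) + p * \<mu> - \<mu> * ((c * r * \<mu> + d * p) + t) = 0"
    and XG: "a * p + b * s = q * (p * a + r * c)" "a * r + b * t = q * (p * b + r * d)"
      "c * p + d * s = q * (s * a + t * c)" "c * r + d * t = q * (s * b + t * d)"
  shows "b = 0 \<and> c = 0 \<and> p = 0 \<and> t = 0 \<and>
    (r = 0 \<and> s \<noteq> 0 \<and> a = \<mu> \<and> d = q * \<mu> \<or> s = 0 \<and> r \<noteq> 0 \<and> a = q * inverse \<mu> \<and> d = inverse \<mu>)"
proof -
  \<comment> \<open>The coefficients of u^2 and v^2 are (1 - \<mu>) a c and (1 - \<mu>) b d. As no
    row of g vanishes, its matrix is diagonal or antidiagonal.\<close>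
  have ac: "a = 0 \<or> c = 0" using GR(1) mu(1) by (auto simp: mult.commute)
  have bd: "b = 0 \<or> d = 0" using GR(2) mu(1) by (auto simp: mult.commute)
  show ?thesis
  proof (cases "a = 0")
    case False
    then have c: "c = 0" and d: "d \<noteq> 0" and b: "b = 0" using ac bd G by auto
    have p: "p = 0" using XG(1) False q c b by (simp add: mult.commute)
    have t: "t = 0" using XG(4) d q b c by (simp add: mult.commute)
    have r: "r = 0 \<or> a = q * d" using XG(2) b p by (simp add: mult.commute)
    have s: "s = 0 \<or> d = q * a" using XG(3) c t by (simp add: mult.commute)
    \<comment> \<open>If both were nonzero, a = q^2 a would give q^2 = 1, and then x^2 = 0 forces r
      s = 0.\<close>
    have "r = 0 \<or> s = 0"
    proof (rule ccontr)
      assume "\<not> (r = 0 \<or> s = 0)"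
      then have "a = q * (q * a)" "r * s \<noteq> 0" using r s by auto
      then have "q ^ 2 = 1" using False by (simp add: power2_eq_square)
      then show False using X2 p \<open>r * s \<noteq> 0\<close> by simp
    qed
    moreover have "a = \<mu>" if "s \<noteq> 0" using XR(1) c p that by (simp add: mult.commute)
    moreover have "d = inverse \<mu>" if "r \<noteq> 0"
    proof -
      have "r * (1 - \<mu> * d) = 0" using XR(2) b by (simp add: algebra_simps)
      then show ?thesis using that mu by (simp add: field_simps)
    qed
    ultimately show ?thesis using X r s p t b c by auto
  next
    case True
    then have b: "b \<noteq> 0" and d: "d = 0" and c: "c \<noteq> 0" using G bd by auto
    have "b * c * (1 - \<mu> * \<mu>) = 0" using GR(3) True by (simp add: algebra_simps)
    then have "(1 - \<mu>) * (1 + \<mu>) = 0" using b c by (simp add: algebra_simps)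
    then have mu1: "\<mu> = - 1" using mu(1) by (simp add: add_eq_0_iff)
    have t: "t = q * p" using XG(2) True d b by (simp add: mult.left_commute)
    have "p = q * t" using XG(3) True d c by (simp add: mult.left_commute)
    then have pq: "p = 0 \<or> q ^ 2 = 1" using t by (auto simp: power2_eq_square)
    have s: "s = - c * p" using XR(1) True mu1 by (simp add: add_eq_0_iff)
    have r: "r = - b * t" using XR(2) d by (simp add: add_eq_0_iff2)
    have p: "p \<noteq> 0" using X t s r by auto
    then have q2: "q ^ 2 = 1" using pq by simp
    then have "(q - 1) * (q + 1) = 0" by (simp add: power2_eq_square algebra_simps)
    then have q1: "q = - 1" using q by (simp add: add_eq_0_iff2)
    have bc: "b * c = 1" using G2 q2 True by simp
    \<comment> \<open>With \<mu> = q = -1 and b c = 1 each of the four terms equals -p, and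
      characteristic zero finishes.\<close>
    have "b * s - p - c * r + t = 0" using XR(3) True d mu1 by (simp add: algebra_simps)
    then have "- (b * c) * p - p - (b * c) * p - p = 0"
      unfolding s r t q1 by (simp add: algebra_simps) (metis minus_minus)
    then have "4 * p = 0" unfolding bc by simp
    then show ?thesis using p by simp
  qed
qed

lemma taft_action_cases:
  assumes action: "taft_action n q {plane_rel \<mu> \<kappa>} act"
    and faithful: "inner_faithful (taft_algebra n q) (presented_algebra {plane_rel \<mu> \<kappa>}) act"
    and mu: "\<mu> \<noteq> 1" "\<mu> \<noteq> 0"
    and gu: "act (taft_g n q) (presented_class {plane_rel \<mu> \<kappa>} (gen Gen_u)) =
      presented_class {plane_rel \<mu> \<kappa>} (scale a (gen Gen_u) + scale b (gen Gen_v))"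
    and gv: "act (taft_g n q) (presented_class {plane_rel \<mu> \<kappa>} (gen Gen_v)) =
      presented_class {plane_rel \<mu> \<kappa>} (scale c (gen Gen_u) + scale d (gen Gen_v))"
    and xu: "act (taft_x n q) (presented_class {plane_rel \<mu> \<kappa>} (gen Gen_u)) =
      presented_class {plane_rel \<mu> \<kappa>} (scale p (gen Gen_u) + scale r (gen Gen_v))"
    and xv: "act (taft_x n q) (presented_class {plane_rel \<mu> \<kappa>} (gen Gen_v)) =
      presented_class {plane_rel \<mu> \<kappa>} (scale s (gen Gen_u) + scale t (gen Gen_v))"
  shows "b = 0 \<and> c = 0 \<and> p = 0 \<and> t = 0 \<and> (\<kappa> \<noteq> 0 \<longrightarrow> a * d = 1) \<and> a ^ n = 1 \<and> d ^ n = 1 \<and>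
    (r = 0 \<and> s \<noteq> 0 \<and> a = \<mu> \<and> d = q * \<mu> \<or> s = 0 \<and> r \<noteq> 0 \<and> a = q * inverse \<mu> \<and> d = inverse \<mu>)"
proof -
  interpret taft_action n q "{plane_rel \<mu> \<kappa>}" act by fact
  let ?u = "gen Gen_u :: (plane_gen, 'a) free_alg" and ?v = "gen Gen_v :: (plane_gen, 'a) free_alg"
  let ?L = "\<lambda>\<alpha> \<beta>. scale \<alpha> ?u + scale \<beta> ?v"
  let ?c = "pbw_coeff \<mu> \<kappa>"
  have coeff: "?c y k = ?c z k" if "pc y = pc z" for y z k
    using that pbw_coeff_rel_ideal[of "y - z" \<mu> \<kappa> k]
    by (simp add: presented_class_eq_iff pbw_coeff_simps)
  have L_eq: "\<alpha> = \<alpha>' \<and> \<beta> = \<beta>'" if "pc (?L \<alpha> \<beta>) = pc (?L \<alpha>' \<beta>')" for \<alpha> \<beta> \<alpha>' \<beta>'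
    using coeff[OF that, of "(0, 1)"] coeff[OF that, of "(1, 0)"]
    by (simp add: pbw_coeff_simps pbw_coeff_monomials)
  have L_mult: "?L \<alpha> \<beta> * ?L \<alpha>' \<beta>' = scale (\<alpha> * \<alpha>') (?u * ?u) + scale (\<alpha> * \<beta>') (?u * ?v)
      + scale (\<beta> * \<alpha>') (?v * ?u) + scale (\<beta> * \<beta>') (?v * ?v)" for \<alpha> \<beta> \<alpha>' \<beta>'
    by (simp add: distrib_left distrib_right scale_add_right mult.commute add_ac)
  have gL: "act_g (pc (?L \<alpha> \<beta>)) = pc (?L (\<alpha> * a + \<beta> * c) (\<alpha> * b + \<beta> * d))" for \<alpha> \<beta>
  proof -
    have "act_g (pc (?L \<alpha> \<beta>)) = pc (scale \<alpha> (?L a b) + scale \<beta> (?L c d))"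
      by (intro act_pc_add act_pc_scale gu gv taft_closed)
    also have "scale \<alpha> (?L a b) + scale \<beta> (?L c d) = ?L (\<alpha> * a + \<beta> * c) (\<alpha> * b + \<beta> * d)"
      by (simp add: scale_add_left scale_add_right)
    finally show ?thesis .
  qed
  have xL: "act_x (pc (?L \<alpha> \<beta>)) = pc (?L (\<alpha> * p + \<beta> * s) (\<alpha> * r + \<beta> * t))" for \<alpha> \<beta>
  proof -
    have "act_x (pc (?L \<alpha> \<beta>)) = pc (scale \<alpha> (?L p r) + scale \<beta> (?L s t))"
      by (intro act_pc_add act_pc_scale xu xv taft_closed)
    also have "scale \<alpha> (?L p r) + scale \<beta> (?L s t) = ?L (\<alpha> * p + \<beta> * s) (\<alpha> * r + \<beta> * t)"
      by (simp add: scale_add_left scale_add_right)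
    finally show ?thesis .
  qed
  have q1: "q \<noteq> 1" using q_order n_gt by (auto simp: has_mult_order_def)
  \<comment> \<open>This is how g^n = 1 and x^n = 0 supply the quadratic conditions
    \<open>G2\<close> and \<open>X2\<close>.\<close>
  have n2: "n = 2" if "q ^ 2 = 1"
  proof -
    have "\<not> 2 < n" using q_order that by (auto simp: has_mult_order_def)
    then show ?thesis using n_gt by simp
  qed
  \<comment> \<open>The relation in a shape built from sums, scalings and products only, so that the
    action rules apply syntactically.\<close>
  let ?E = "?u * ?v + (scale (- \<mu>) (?v * ?u) + scale (- \<kappa>) 1)"
  have rel: "plane_rel \<mu> \<kappa> = ?E"
    using const_mult[of \<kappa> "1 :: (plane_gen, 'a) free_alg"] by (simp add: plane_rel_def scale_minus_left)
  have rel_zero: "pc ?E = pc 0"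
    unfolding rel [symmetric] by (simp add: presented_class_eq_zero_iff rel_ideal_base)
  let ?EG = "?L a b * ?L c d + (scale (- \<mu>) (?L c d * ?L a b) + scale (- \<kappa>) 1)"
  let ?EX = "(?L a b * ?L s t + ?L p r * ?v) + (scale (- \<mu>) (?L c d * ?L p r + ?L s t * ?u) + scale (- \<kappa>) 0)"
  have "act_g (pc ?E) = pc ?EG"
    by (intro act_pc_add act_pc_scale act_g_mult act_g_one gu gv taft_closed)
  then have EG: "pc ?EG = pc 0" by (simp only: rel_zero act_pc_zero taft_closed)
  have "act_x (pc ?E) = pc ?EX"
    by (intro act_pc_add act_pc_scale act_x_mult act_x_one gu gv xu xv taft_closed)
  then have EX: "pc ?EX = pc 0" by (simp only: rel_zero act_pc_zero taft_closed)
  note coeff_simps = L_mult pbw_coeff_simps pbw_coeff_monomials distrib_right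
  have zero: "?c 0 k = 0" for k by (rule pbw_coeff_rel_ideal) simp
  have GR: "a * c - \<mu> * (c * a) = 0" "b * d - \<mu> * (d * b) = 0"
      "(a * d * \<mu> + b * c) - \<mu> * (c * b * \<mu> + d * a) = 0" "\<kappa> * (a * d - \<mu> * (c * b) - 1) = 0"
    using coeff[OF EG, of "(0, 2)"] coeff[OF EG, of "(2, 0)"] coeff[OF EG, of "(1, 1)"]
      coeff[OF EG, of "(0, 0)"]
    by (simp_all add: coeff_simps zero algebra_simps)
  have XR: "a * s - \<mu> * (c * p + s) = 0" "b * t + r - \<mu> * (d * r) = 0"
      "(a * t * \<mu> + b * s) + p * \<mu> - \<mu> * ((c * r * \<mu> + d * p) + t) = 0"
    using coeff[OF EX, of "(0, 2)"] coeff[OF EX, of "(2, 0)"] coeff[OF EX, of "(1, 1)"]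
    by (simp_all add: coeff_simps zero algebra_simps)
  have xgL: "pc (?L (\<alpha> * p + \<beta> * s) (\<alpha> * r + \<beta> * t)) =
      pc (?L (q * (\<gamma> * a + \<delta> * c)) (q * (\<gamma> * b + \<delta> * d)))"
    if "act_g (pc y) = pc (?L \<alpha> \<beta>)" "act_x (pc y) = pc (?L \<gamma> \<delta>)" for y \<alpha> \<beta> \<gamma> \<delta>
    using act_x_g[of y] unfolding that xL gL by (simp add: scale_add_right)
  note XG = L_eq[OF xgL[OF gu xu]] L_eq[OF xgL[OF gv xv]]
  \<comment> \<open>g is injective because g^n = 1; hence neither row of its matrix is zero.\<close>
  have g_inj: "\<alpha> \<noteq> 0 \<or> \<beta> \<noteq> 0" if "act_g (pc (?L \<gamma> \<delta>)) = pc (?L \<alpha> \<beta>)" "\<gamma> \<noteq> 0 \<or> \<delta> \<noteq> 0" for \<alpha> \<beta> \<gamma> \<delta>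
  proof (rule ccontr)
    assume "\<not> (\<alpha> \<noteq> 0 \<or> \<beta> \<noteq> 0)"
    then have "act_g (pc (?L \<gamma> \<delta>)) = pc 0" using that(1) by simp
    then have "(act_g ^^ Suc k) (pc (?L \<gamma> \<delta>)) = pc 0" for k
      by (induction k) (simp_all add: act_pc_zero)
    from this[of "n - 1"] have "pc (?L \<gamma> \<delta>) = pc (?L 0 0)"
      using act_g_power[of "?L \<gamma> \<delta>"] n_gt by simp
    from L_eq[OF this] show False using that(2) by simp
  qed
  have G: "a \<noteq> 0 \<or> b \<noteq> 0" "c \<noteq> 0 \<or> d \<noteq> 0"
    using g_inj[of 1 0 a b] g_inj[of 0 1 c d] gL[of 1 0] gL[of 0 1] by simp_all
  have X: "p \<noteq> 0 \<or> r \<noteq> 0 \<or> s \<noteq> 0 \<or> t \<noteq> 0"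
    using act_x_nonzero[OF action faithful] xu xv by fastforce
  have G2: "a * a + b * c = 1" if "q ^ 2 = 1"
  proof -
    have "act_g (act_g (pc (?L 1 0))) = pc (?L 1 0)"
      using act_g_power[of "?L 1 0"] n2[OF that] by (simp add: numeral_2_eq_2)
    then have "pc (?L (a * a + b * c) (a * b + b * d)) = pc (?L 1 0)" by (simp only: gL) simp
    from L_eq[OF this] show ?thesis by simp
  qed
  have X2: "p * p + r * s = 0" if "q ^ 2 = 1"
  proof -
    have "act_x (act_x (pc (?L 1 0))) = pc (?L 0 0)"
      using act_x_power[of "?L 1 0"] n2[OF that] by (simp add: numeral_2_eq_2)
    then have "pc (?L (p * p + r * s) (p * r + r * t)) = pc (?L 0 0)" by (simp only: xL) simp
    from L_eq[OF this] show ?thesis by simp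
  qed
  have cases: "b = 0 \<and> c = 0 \<and> p = 0 \<and> t = 0 \<and>
    (r = 0 \<and> s \<noteq> 0 \<and> a = \<mu> \<and> d = q * \<mu> \<or> s = 0 \<and> r \<noteq> 0 \<and> a = q * inverse \<mu> \<and> d = inverse \<mu>)"
    by (rule matrix_cases[OF q1 mu G X G2 X2 GR(1-3) XR]) (use XG in simp_all)
  \<comment> \<open>g is diagonal by now, so g^n = 1 evaluated at u + v yields both a^n = 1 and d^n
    = 1.\<close>
  have "(act_g ^^ k) (pc (?L \<alpha> \<beta>)) = pc (?L (\<alpha> * a ^ k) (\<beta> * d ^ k))" for k \<alpha> \<beta>
    using cases by (induction k) (simp_all only: funpow.simps comp_def gL, simp_all add: mult_ac)
  from this[of n 1 1] have "pc (?L (a ^ n) (d ^ n)) = pc (?L 1 1)"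
    by (simp add: act_g_power)
  \<comment> \<open>With c = 0 the constant coefficient \<open>GR(4)\<close> leaves \<kappa> (a d -
    1) = 0.\<close>
  from L_eq[OF this] show ?thesis using cases GR(4) by auto
qed



section \<open>The two algebras and the two families\<close>

lemma quantum_plane_rels_eq: "quantum_plane_rels \<mu> = {plane_rel \<mu> 0}"
  by (simp add: quantum_plane_rels_def plane_rel_def const_mult mult.assoc const_def [of 0])

lemma quantum_weyl_rels_eq: "quantum_weyl_rels \<mu> = {plane_rel \<mu> 1}"
  by (simp add: quantum_weyl_rels_def plane_rel_def const_mult mult.assoc const_def [of 1])

lemma mult_order_dvd_iff:
  assumes "has_mult_order a m"
  shows "m dvd n \<longleftrightarrow> a ^ n = 1"
proof -
  have "a ^ n = (a ^ m) ^ (n div m) * a ^ (n mod m)"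
    by (metis mult_div_mod_eq power_add power_mult)
  also have "\<dots> = a ^ (n mod m)"
    using assms by (simp add: has_mult_order_def)
  finally have "a ^ n = a ^ (n mod m)" .
  moreover have "a ^ (n mod m) = 1 \<longleftrightarrow> n mod m = 0"
    using assms unfolding has_mult_order_def by (metis mod_less_divisor neq0_conv power_0)
  ultimately show ?thesis by (simp add: dvd_eq_mod_eq_0)
qed

context skew_derivation
begin

text \<open>\<open>G\<close> multiplies the quadratic part by q \<alpha>^2 and fixes the constant,
  leaving \<kappa> (q \<alpha>^2 - 1). \<open>X\<close> kills the relation itself: its c^2
  coefficient is \<eta> (\<alpha> - \<mu>) in the first case and \<eta> (1 - \<mu> \<alpha>) in the
  second.\<close>

lemma plane_rel_stable:
  assumes cd: "c = Gen_u \<and> d = Gen_v \<and> \<alpha> = \<mu> \<or> c = Gen_v \<and> d = Gen_u \<and> \<alpha> = inverse \<mu>"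
    and "\<mu> \<noteq> 0" and \<kappa>: "\<kappa> \<noteq> 0 \<Longrightarrow> q * \<alpha> ^ 2 = 1"
  shows "G (plane_rel \<mu> \<kappa>) \<in> rel_ideal {plane_rel \<mu> \<kappa>}" "X (plane_rel \<mu> \<kappa>) \<in> rel_ideal {plane_rel \<mu> \<kappa>}"
proof -
  have const: "const \<kappa> = scale \<kappa> (1 :: (plane_gen, 'k) free_alg)"
    using const_mult[of \<kappa> 1] by simp
  have "G (plane_rel \<mu> \<kappa>) = scale (q * \<alpha> ^ 2) (plane_rel \<mu> \<kappa>) + scale (q * \<alpha> ^ 2 * \<kappa> - \<kappa>) 1"
    using cd G_gen unfolding plane_rel_def const
    by (auto simp: lin_diff[OF lin_G] G_lin_simps G_mult G_one scale_diff_right scale_diff_left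
        power2_eq_square mult_ac)
  moreover have "q * \<alpha> ^ 2 * \<kappa> - \<kappa> = 0" using \<kappa> by (cases "\<kappa> = 0") simp_all
  ultimately show "G (plane_rel \<mu> \<kappa>) \<in> rel_ideal {plane_rel \<mu> \<kappa>}"
    by (simp add: rel_ideal_scale rel_ideal_base)
  have "X (plane_rel \<mu> \<kappa>) = 0"
    using cd G_gen X_gen \<open>\<mu> \<noteq> 0\<close> unfolding plane_rel_def const
    by (auto simp: lin_diff[OF lin_X] X_lin_simps X_mult X_one mult_ac)
  then show "X (plane_rel \<mu> \<kappa>) \<in> rel_ideal {plane_rel \<mu> \<kappa>}" by simp
qed

lemma taft_plane_plane_rel:
  assumes "c = Gen_u \<and> d = Gen_v \<and> \<alpha> = \<mu> \<or> c = Gen_v \<and> d = Gen_u \<and> \<alpha> = inverse \<mu>"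
    and "\<mu> \<noteq> 0" "\<kappa> \<noteq> 0 \<Longrightarrow> q * \<alpha> ^ 2 = 1"
  shows "taft_plane n q \<alpha> \<eta> c d {plane_rel \<mu> \<kappa>}"
proof
  fix a b assume "scale a (gen c) + scale b (gen d) \<in> rel_ideal {plane_rel \<mu> \<kappa>}"
  then show "a = 0 \<and> b = 0"
    using assms(1) plane_gens_independent[of a b \<mu> \<kappa>] plane_gens_independent[of b a \<mu> \<kappa>]
    by (auto simp: add.commute)
qed (use plane_rel_stable[of \<mu> \<kappa>] assms in simp_all)

end

context taft_plane
begin

lemma act_gens:
  "act (taft_g n q) (presented_class R (gen c)) = presented_class R (scale \<alpha> (gen c))"
  "act (taft_g n q) (presented_class R (gen d)) = presented_class R (scale (q * \<alpha>) (gen d))"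
  "act (taft_x n q) (presented_class R (gen c)) = presented_class R 0"
  "act (taft_x n q) (presented_class R (gen d)) = presented_class R (scale \<eta> (gen c))"
  by (simp_all add: act_class hrep_gen T_simps G_gen X_gen)

lemma linear_taft_action_act: "linear_taft_action n q R act"
proof -
  have "\<exists>a b. act h (presented_class R (gen e)) =
      presented_class R (scale a (gen Gen_u) + scale b (gen Gen_v))" for h e
  proof -
    obtain a b where ab: "hrep h (gen e) = scale a (gen c) + scale b (gen d)"
      using rep_gen_span unfolding hrep_def by blast
    have "c = Gen_u \<and> d = Gen_v \<or> c = Gen_v \<and> d = Gen_u"
      using c_neq_d by (cases c; cases d) auto
    then show ?thesis
      unfolding act_class ab by (metis add.commute)
  qed
  then show ?thesis
    unfolding linear_taft_action_def Let_def using hopf_action_act by simp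
qed

end

lemma linear_taft_action_cases:
  fixes q \<mu> \<kappa> :: "'k::field_char_0"
  defines "R \<equiv> {plane_rel \<mu> \<kappa>}"
  assumes n: "n > 1" "has_mult_order q n" and mu: "\<mu> \<noteq> 1" "\<mu> \<noteq> 0"
    and action: "linear_taft_action n q R act"
    and faithful: "inner_faithful (taft_algebra n q) (presented_algebra R) act"
  shows "\<mu> ^ n = 1 \<and> (\<exists>\<eta>. \<eta> \<noteq> 0 \<and>
    (act (taft_g n q) (presented_class R (gen Gen_u)) = presented_class R (scale \<mu> (gen Gen_u)) \<and>
     act (taft_g n q) (presented_class R (gen Gen_v)) = presented_class R (scale (q * \<mu>) (gen Gen_v)) \<and>
     act (taft_x n q) (presented_class R (gen Gen_u)) = presented_class R 0 \<and>
     act (taft_x n q) (presented_class R (gen Gen_v)) = presented_class R (scale \<eta> (gen Gen_u)) \<and>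
     (\<kappa> \<noteq> 0 \<longrightarrow> q = inverse (\<mu> ^ 2)) \<or>
     act (taft_g n q) (presented_class R (gen Gen_u)) = presented_class R (scale (q * inverse \<mu>) (gen Gen_u)) \<and>
     act (taft_g n q) (presented_class R (gen Gen_v)) = presented_class R (scale (inverse \<mu>) (gen Gen_v)) \<and>
     act (taft_x n q) (presented_class R (gen Gen_u)) = presented_class R (scale \<eta> (gen Gen_v)) \<and>
     act (taft_x n q) (presented_class R (gen Gen_v)) = presented_class R 0 \<and>
     (\<kappa> \<noteq> 0 \<longrightarrow> q = \<mu> ^ 2)))"
proof -
  have hopf: "taft_action n q R act"
    using action n by (simp add: taft_action_def taft_action_axioms_def linear_taft_action_def)
  obtain a b where gu: "act (taft_g n q) (presented_class R (gen Gen_u)) =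
      presented_class R (scale a (gen Gen_u) + scale b (gen Gen_v))"
    using action by (auto simp: linear_taft_action_def Let_def)
  obtain c d where gv: "act (taft_g n q) (presented_class R (gen Gen_v)) =
      presented_class R (scale c (gen Gen_u) + scale d (gen Gen_v))"
    using action by (auto simp: linear_taft_action_def Let_def)
  obtain p r where xu: "act (taft_x n q) (presented_class R (gen Gen_u)) =
      presented_class R (scale p (gen Gen_u) + scale r (gen Gen_v))"
    using action by (auto simp: linear_taft_action_def Let_def)
  obtain s t where xv: "act (taft_x n q) (presented_class R (gen Gen_v)) =
      presented_class R (scale s (gen Gen_u) + scale t (gen Gen_v))"
    using action by (auto simp: linear_taft_action_def Let_def)
  note cases = taft_action_cases[OF hopf[unfolded R_def] faithful[unfolded R_def] mu
      gu[unfolded R_def] gv[unfolded R_def] xu[unfolded R_def] xv[unfolded R_def]]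
  then have zeros: "b = 0" "c = 0" "p = 0" "t = 0" and "a ^ n = 1" "d ^ n = 1"
    and \<kappa>: "\<kappa> \<noteq> 0 \<Longrightarrow> a * d = 1" by auto
  consider (1) "r = 0" "s \<noteq> 0" "a = \<mu>" "d = q * \<mu>"
    | (2) "s = 0" "r \<noteq> 0" "a = q * inverse \<mu>" "d = inverse \<mu>"
    using cases by blast
  then show ?thesis
  proof cases
    case 1
    \<comment> \<open>Here a d = q \<mu>^2; in the other family a d = q \<mu>^(-2).\<close>
    have "q = inverse (\<mu> ^ 2)" if "\<kappa> \<noteq> 0"
      using \<kappa>[OF that] 1 mu by (simp add: field_simps power2_eq_square)
    then show ?thesis
      using gu gv xu xv zeros 1 \<open>a ^ n = 1\<close> by (intro conjI exI[of _ s]) auto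
  next
    case 2
    have "q = \<mu> ^ 2" if "\<kappa> \<noteq> 0"
      using \<kappa>[OF that] 2 mu by (simp add: field_simps power2_eq_square)
    moreover have "\<mu> ^ n = 1" using \<open>d ^ n = 1\<close> 2 mu by (simp add: power_inverse)
    ultimately show ?thesis
      using gu gv xu xv zeros 2 by (intro conjI exI[of _ r]) auto
  qed
qed



text \<open>The last two conjuncts state that, under the stated conditions, each family really
  occurs for every nonzero \<eta>; the second conjunct is the classification.\<close>

theorem proposition2p1:
  fixes q \<mu> :: "'k::{alg_closed_field, field_char_0}" and n m :: nat
    and R :: "(plane_gen, 'k) free_alg set"
  assumes n: "n > 1" and q: "has_mult_order q n"
    and m: "m > 1" and mu: "has_mult_order \<mu> m"
    and R: "R = quantum_plane_rels \<mu> \<or> R = quantum_weyl_rels \<mu>"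
    and H: "H = taft_algebra n q" and g: "g = taft_g n q" and x: "x = taft_x n q"
    and A: "A = presented_algebra R"
    and u: "u = presented_class R (gen Gen_u)" and v: "v = presented_class R (gen Gen_v)"
  shows
    "((\<exists>act. linear_taft_action n q R act \<and> inner_faithful H A act) \<longleftrightarrow>
        m dvd n \<and> (R = quantum_weyl_rels \<mu> \<longrightarrow> q = inverse (\<mu> ^ 2) \<or> q = \<mu> ^ 2)) \<and>
     (\<forall>act. linear_taft_action n q R act \<and> inner_faithful H A act \<longrightarrow>
        (\<exists>\<eta>. \<eta> \<noteq> 0 \<and>
          act g u = \<mu> \<odot>\<^bsub>A\<^esub> u \<and> act g v = (q * \<mu>) \<odot>\<^bsub>A\<^esub> v \<and>
          act x u = \<zero>\<^bsub>A\<^esub> \<and> act x v = \<eta> \<odot>\<^bsub>A\<^esub> u \<and>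
          (R = quantum_weyl_rels \<mu> \<longrightarrow> q = inverse (\<mu> ^ 2))) \<or>
        (\<exists>\<eta>. \<eta> \<noteq> 0 \<and>
          act g u = (q * inverse \<mu>) \<odot>\<^bsub>A\<^esub> u \<and> act g v = inverse \<mu> \<odot>\<^bsub>A\<^esub> v \<and>
          act x u = \<eta> \<odot>\<^bsub>A\<^esub> v \<and> act x v = \<zero>\<^bsub>A\<^esub> \<and>
          (R = quantum_weyl_rels \<mu> \<longrightarrow> q = \<mu> ^ 2))) \<and>
     (\<forall>\<eta>. m dvd n \<and> \<eta> \<noteq> 0 \<and> (R = quantum_weyl_rels \<mu> \<longrightarrow> q = inverse (\<mu> ^ 2)) \<longrightarrow>
        (\<exists>act. linear_taft_action n q R act \<and> inner_faithful H A act \<and>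
          act g u = \<mu> \<odot>\<^bsub>A\<^esub> u \<and> act g v = (q * \<mu>) \<odot>\<^bsub>A\<^esub> v \<and>
          act x u = \<zero>\<^bsub>A\<^esub> \<and> act x v = \<eta> \<odot>\<^bsub>A\<^esub> u)) \<and>
     (\<forall>\<eta>. m dvd n \<and> \<eta> \<noteq> 0 \<and> (R = quantum_weyl_rels \<mu> \<longrightarrow> q = \<mu> ^ 2) \<longrightarrow>
        (\<exists>act. linear_taft_action n q R act \<and> inner_faithful H A act \<and>
          act g u = (q * inverse \<mu>) \<odot>\<^bsub>A\<^esub> u \<and> act g v = inverse \<mu> \<odot>\<^bsub>A\<^esub> v \<and>
          act x u = \<eta> \<odot>\<^bsub>A\<^esub> v \<and> act x v = \<zero>\<^bsub>A\<^esub>))"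
proof -
  \<comment> \<open>Testing \<open>R\<close> itself makes \<open>weyl\<close> immediate, without
    showing that the two sets of relations differ.\<close>
  define \<kappa> :: 'k where "\<kappa> = (if R = quantum_weyl_rels \<mu> then 1 else 0)"
  have R_eq: "R = {plane_rel \<mu> \<kappa>}"
    using R by (auto simp: \<kappa>_def quantum_plane_rels_eq quantum_weyl_rels_eq)
  have weyl: "R = quantum_weyl_rels \<mu> \<longleftrightarrow> \<kappa> \<noteq> 0" by (simp add: \<kappa>_def)
  have mu0: "\<mu> \<noteq> 0" and mu1: "\<mu> \<noteq> 1"
    using m mu by (auto simp: has_mult_order_def power_0_left)
  have dvd: "m dvd n \<longleftrightarrow> \<mu> ^ n = 1" by (rule mult_order_dvd_iff[OF mu])
  have scalar: "c \<odot>\<^bsub>A\<^esub> u = presented_class R (scale c (gen Gen_u))"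
    "c \<odot>\<^bsub>A\<^esub> v = presented_class R (scale c (gen Gen_v))" for c
    by (simp_all add: A u v)
  have zero: "\<zero>\<^bsub>A\<^esub> = presented_class R 0" by (simp add: A zero_presented)
  note eqs = scalar zero H g x u v
  note cases = linear_taft_action_cases[of n q \<mu> \<kappa>, folded R_eq, OF n q mu1 mu0]
  have ex1: "\<exists>act. linear_taft_action n q R act \<and> inner_faithful H A act \<and>
      act g u = \<mu> \<odot>\<^bsub>A\<^esub> u \<and> act g v = (q * \<mu>) \<odot>\<^bsub>A\<^esub> v \<and>
      act x u = \<zero>\<^bsub>A\<^esub> \<and> act x v = \<eta> \<odot>\<^bsub>A\<^esub> u"
    if *: "m dvd n" "\<eta> \<noteq> 0" "R = quantum_weyl_rels \<mu> \<longrightarrow> q = inverse (\<mu> ^ 2)" for \<eta>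
  proof -
    interpret skew_derivation n q \<mu> \<eta> Gen_u Gen_v
      by standard (use n q * dvd in simp_all)
    interpret taft_plane n q \<mu> \<eta> Gen_u Gen_v R
      unfolding R_eq by (rule taft_plane_plane_rel) (use * mu0 weyl in simp_all)
    show ?thesis
      unfolding A H g x u v zero_presented smult_presented
      by (intro exI[of _ act] conjI linear_taft_action_act inner_faithful_act act_gens)
  qed
  have ex2: "\<exists>act. linear_taft_action n q R act \<and> inner_faithful H A act \<and>
      act g u = (q * inverse \<mu>) \<odot>\<^bsub>A\<^esub> u \<and> act g v = inverse \<mu> \<odot>\<^bsub>A\<^esub> v \<and>
      act x u = \<eta> \<odot>\<^bsub>A\<^esub> v \<and> act x v = \<zero>\<^bsub>A\<^esub>"
    if *: "m dvd n" "\<eta> \<noteq> 0" "R = quantum_weyl_rels \<mu> \<longrightarrow> q = \<mu> ^ 2" for \<eta>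
  proof -
    \<comment> \<open>The second family is the first with u and v exchanged and \<mu> inverted; the
      Weyl condition q \<alpha>^2 = 1 becomes q = \<mu>^2.\<close>
    interpret skew_derivation n q "inverse \<mu>" \<eta> Gen_v Gen_u
      by standard (use n q * dvd in \<open>simp_all add: power_inverse\<close>)
    interpret taft_plane n q "inverse \<mu>" \<eta> Gen_v Gen_u R
      unfolding R_eq by (rule taft_plane_plane_rel)
        (use * mu0 weyl in \<open>simp_all add: power_inverse\<close>)
    show ?thesis
      unfolding A H g x u v zero_presented smult_presented
      by (intro exI[of _ act] conjI linear_taft_action_act inner_faithful_act act_gens)
  qed
  have order: "m dvd n" and classify: "(\<exists>\<eta>. \<eta> \<noteq> 0 \<and>
          act g u = \<mu> \<odot>\<^bsub>A\<^esub> u \<and> act g v = (q * \<mu>) \<odot>\<^bsub>A\<^esub> v \<and>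
          act x u = \<zero>\<^bsub>A\<^esub> \<and> act x v = \<eta> \<odot>\<^bsub>A\<^esub> u \<and>
          (R = quantum_weyl_rels \<mu> \<longrightarrow> q = inverse (\<mu> ^ 2))) \<or>
        (\<exists>\<eta>. \<eta> \<noteq> 0 \<and>
          act g u = (q * inverse \<mu>) \<odot>\<^bsub>A\<^esub> u \<and> act g v = inverse \<mu> \<odot>\<^bsub>A\<^esub> v \<and>
          act x u = \<eta> \<odot>\<^bsub>A\<^esub> v \<and> act x v = \<zero>\<^bsub>A\<^esub> \<and>
          (R = quantum_weyl_rels \<mu> \<longrightarrow> q = \<mu> ^ 2))"
    if *: "linear_taft_action n q R act \<and> inner_faithful H A act" for act
  proof -
    have "inner_faithful (taft_algebra n q) (presented_algebra R) act" using * by (simp only: H A)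
    note cs = cases[OF conjunct1[OF *] this, folded weyl g x u v, folded scalar zero]
    show "m dvd n" unfolding dvd by (rule conjunct1[OF cs])
    obtain \<eta> where "\<eta> \<noteq> 0" and
      "act g u = \<mu> \<odot>\<^bsub>A\<^esub> u \<and> act g v = (q * \<mu>) \<odot>\<^bsub>A\<^esub> v \<and>
          act x u = \<zero>\<^bsub>A\<^esub> \<and> act x v = \<eta> \<odot>\<^bsub>A\<^esub> u \<and>
          (R = quantum_weyl_rels \<mu> \<longrightarrow> q = inverse (\<mu> ^ 2)) \<or>
        act g u = (q * inverse \<mu>) \<odot>\<^bsub>A\<^esub> u \<and> act g v = inverse \<mu> \<odot>\<^bsub>A\<^esub> v \<and>
          act x u = \<eta> \<odot>\<^bsub>A\<^esub> v \<and> act x v = \<zero>\<^bsub>A\<^esub> \<and>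
          (R = quantum_weyl_rels \<mu> \<longrightarrow> q = \<mu> ^ 2)"
      using conjunct2[OF cs] by (elim exE conjE[of "_ \<noteq> _"]) (rule that)
    then show "(\<exists>\<eta>. \<eta> \<noteq> 0 \<and>
          act g u = \<mu> \<odot>\<^bsub>A\<^esub> u \<and> act g v = (q * \<mu>) \<odot>\<^bsub>A\<^esub> v \<and>
          act x u = \<zero>\<^bsub>A\<^esub> \<and> act x v = \<eta> \<odot>\<^bsub>A\<^esub> u \<and>
          (R = quantum_weyl_rels \<mu> \<longrightarrow> q = inverse (\<mu> ^ 2))) \<or>
        (\<exists>\<eta>. \<eta> \<noteq> 0 \<and>
          act g u = (q * inverse \<mu>) \<odot>\<^bsub>A\<^esub> u \<and> act g v = inverse \<mu> \<odot>\<^bsub>A\<^esub> v \<and>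
          act x u = \<eta> \<odot>\<^bsub>A\<^esub> v \<and> act x v = \<zero>\<^bsub>A\<^esub> \<and>
          (R = quantum_weyl_rels \<mu> \<longrightarrow> q = \<mu> ^ 2))"
      by blast
  qed
  show ?thesis
  proof (intro conjI iffI allI impI)
    assume "\<exists>act. linear_taft_action n q R act \<and> inner_faithful H A act"
    then obtain act where act: "linear_taft_action n q R act \<and> inner_faithful H A act" by blast
    show "m dvd n" by (rule order[OF act])
    show "q = inverse (\<mu> ^ 2) \<or> q = \<mu> ^ 2" if "R = quantum_weyl_rels \<mu>"
      using classify[OF act] that by blast
  next
    assume "m dvd n \<and> (R = quantum_weyl_rels \<mu> \<longrightarrow> q = inverse (\<mu> ^ 2) \<or> q = \<mu> ^ 2)"
    then show "\<exists>act. linear_taft_action n q R act \<and> inner_faithful H A act"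
      using ex1[of 1] ex2[of 1] zero_neq_one by metis
  next
    fix act assume "linear_taft_action n q R act \<and> inner_faithful H A act"
    then show "(\<exists>\<eta>. \<eta> \<noteq> 0 \<and>
          act g u = \<mu> \<odot>\<^bsub>A\<^esub> u \<and> act g v = (q * \<mu>) \<odot>\<^bsub>A\<^esub> v \<and>
          act x u = \<zero>\<^bsub>A\<^esub> \<and> act x v = \<eta> \<odot>\<^bsub>A\<^esub> u \<and>
          (R = quantum_weyl_rels \<mu> \<longrightarrow> q = inverse (\<mu> ^ 2))) \<or>
        (\<exists>\<eta>. \<eta> \<noteq> 0 \<and>
          act g u = (q * inverse \<mu>) \<odot>\<^bsub>A\<^esub> u \<and> act g v = inverse \<mu> \<odot>\<^bsub>A\<^esub> v \<and>
          act x u = \<eta> \<odot>\<^bsub>A\<^esub> v \<and> act x v = \<zero>\<^bsub>A\<^esub> \<and>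
          (R = quantum_weyl_rels \<mu> \<longrightarrow> q = \<mu> ^ 2))"
      by (rule classify)
  next
    fix \<eta> :: 'k assume "m dvd n \<and> \<eta> \<noteq> 0 \<and> (R = quantum_weyl_rels \<mu> \<longrightarrow> q = inverse (\<mu> ^ 2))"
    then show "\<exists>act. linear_taft_action n q R act \<and> inner_faithful H A act \<and>
          act g u = \<mu> \<odot>\<^bsub>A\<^esub> u \<and> act g v = (q * \<mu>) \<odot>\<^bsub>A\<^esub> v \<and>
          act x u = \<zero>\<^bsub>A\<^esub> \<and> act x v = \<eta> \<odot>\<^bsub>A\<^esub> u"
      using ex1 by blast
  next
    fix \<eta> :: 'k assume "m dvd n \<and> \<eta> \<noteq> 0 \<and> (R = quantum_weyl_rels \<mu> \<longrightarrow> q = \<mu> ^ 2)"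
    then show "\<exists>act. linear_taft_action n q R act \<and> inner_faithful H A act \<and>
          act g u = (q * inverse \<mu>) \<odot>\<^bsub>A\<^esub> u \<and> act g v = inverse \<mu> \<odot>\<^bsub>A\<^esub> v \<and>
          act x u = \<eta> \<odot>\<^bsub>A\<^esub> v \<and> act x v = \<zero>\<^bsub>A\<^esub>"
      using ex2 by blast
  qed
qed

end
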